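(* Let $\Omega\subset\mathbb{R}^n$ be an open set and suppose that $u$ is a weak supersolution in $\Omega$. Then, for every $k\in\mathbb{R}$, $\min\{u,k\}$ is a weak supersolution in $\Omega$ as well.
   Context: Standing assumptions: $n\ge1$ is an integer, $s\in(0,1)$, $p\in(1,\infty)$, $\Lambda\ge1$, and $K:\mathbb{R}^n\times\mathbb{R}^n\to[0,\infty)$ is a measurable symmetric kernel ($K(x,y)=K(y,x)$) with $\Lambda^{-1}\le K(x,y)|x-y|^{n+sp}\le\Lambda$ for a.e. $x,y\in\mathbb{R}^n$. $D\Subset\Omega$ means that $\overline D$ is a compact subset of $\Omega$; $u_-:=\max\{-u,0\}$. $W^{s,p}(U)$ consists of $v\in L^p(U)$ with $\int_U\int_U\frac{|v(x)-v(y)|^p}{|x-y|^{n+sp}}\,dx\,dy<\infty$; $v\in W^{s,p}_{\rm loc}(\Omega)$ means $v\in W^{s,p}(D)$ for every open $D\Subset\Omega$. The tail space is $L^{p-1}_{sp}(\mathbb{R}^n):=\{f\in L^{p-1}_{\rm loc}(\mathbb{R}^n):\int_{\mathbb{R}^n}|f(x)|^{p-1}(1+|x|)^{-n-sp}\,dx<\infty\}$. A weak supersolution in $\Omega$ is a measurable function $u$ on $\mathbb{R}^n$ with $u\in W^{s,p}_{\rm loc}(\Omega)$, $u_-\in L^{p-1}_{sp}(\mathbb{R}^n)$, and $$\int_{\mathbb{R}^n}\int_{\mathbb{R}^n}|u(x)-u(y)|^{p-2}(u(x)-u(y))(\eta(x)-\eta(y))K(x,y)\,dx\,dy\ge0$$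 for every nonnegative $\eta\in C_0^\infty(\Omega)$. *)

theory Defs
  imports "HOL-Analysis.Analysis"
begin

text \<open>Measurability and integrals refer to \<^const>\<open>lebesgue\<close>, the completed Lebesgue measure;
  double integrals are integrals with respect to Lebesgue measure on the product space.
  Note \<^prop>\<open>0 powr a = (0::real)\<close> for every exponent, so the integrands of the double integrals vanish on the
  diagonal, which is a null set.\<close>

definition sp_kernel :: "real \<Rightarrow> real \<Rightarrow> real \<Rightarrow> (real^'n \<Rightarrow> real^'n \<Rightarrow> real) \<Rightarrow> bool" where
  "sp_kernel s p \<Lambda> K \<longleftrightarrow>
     (\<forall>x y. 0 \<le> K x y) \<and>
     (\<forall>x y. K x y = K y x) \<and>
     (\<lambda>(x, y). K x y) \<in> borel_measurable lebesgue \<and>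
     (AE (x, y) in lebesgue.
        1 / \<Lambda> \<le> K x y * norm (x - y) powr (real CARD('n) + s * p) \<and>
        K x y * norm (x - y) powr (real CARD('n) + s * p) \<le> \<Lambda>)"

definition compactly_contained :: "'a::topological_space set \<Rightarrow> 'a set \<Rightarrow> bool" where
  "compactly_contained D \<Omega> \<longleftrightarrow> compact (closure D) \<and> closure D \<subseteq> \<Omega>"

definition Lebesgue_Lp :: "real \<Rightarrow> 'a::euclidean_space set \<Rightarrow> ('a \<Rightarrow> real) set" where
  "Lebesgue_Lp q U = {v. v \<in> borel_measurable (lebesgue_on U) \<and>
     integrable (lebesgue_on U) (\<lambda>x. \<bar>v x\<bar> powr q)}"

definition Wsp :: "real \<Rightarrow> real \<Rightarrow> (real^'n) set \<Rightarrow> (real^'n \<Rightarrow> real) set" where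
  "Wsp s p U = {v. v \<in> Lebesgue_Lp p U \<and>
     integrable (lebesgue_on (U \<times> U))
       (\<lambda>(x, y). \<bar>v x - v y\<bar> powr p / norm (x - y) powr (real CARD('n) + s * p))}"

definition Wsp_loc :: "real \<Rightarrow> real \<Rightarrow> (real^'n) set \<Rightarrow> (real^'n \<Rightarrow> real) set" where
  "Wsp_loc s p \<Omega> = {v. \<forall>D. open D \<and> compactly_contained D \<Omega> \<longrightarrow> v \<in> Wsp s p D}"

definition tail_space :: "real \<Rightarrow> real \<Rightarrow> (real^'n \<Rightarrow> real) set" where
  "tail_space s p = {f. f \<in> borel_measurable lebesgue \<and>
     (\<forall>C. compact C \<longrightarrow> f \<in> Lebesgue_Lp (p - 1) C) \<and>
     integrable lebesgue
       (\<lambda>x. \<bar>f x\<bar> powr (p - 1) * (1 + norm x) powr (- real CARD('n) - s * p))}"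

text \<open>\<open>C_diff k f\<close> says that \<open>f\<close> is of class \<open>C\<^sup>k\<close> on the whole space: all
  iterated directional derivatives up to order \<open>k\<close> exist (as values of Frechet derivatives) and
  are continuous.\<close>

primrec C_diff :: "nat \<Rightarrow> ('a::euclidean_space \<Rightarrow> real) \<Rightarrow> bool" where
  "C_diff 0 f \<longleftrightarrow> continuous_on UNIV f"
| "C_diff (Suc k) f \<longleftrightarrow> (\<forall>x. f differentiable (at x)) \<and>
     (\<forall>v. C_diff k (\<lambda>x. frechet_derivative f (at x) v))"

definition test_functions :: "'a::euclidean_space set \<Rightarrow> ('a \<Rightarrow> real) set" where
  "test_functions \<Omega> = {\<eta>. (\<forall>k. C_diff k \<eta>) \<and> compactly_contained {x. \<eta> x \<noteq> 0} \<Omega>}"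

definition weak_form_integrand ::
    "real \<Rightarrow> ('a \<Rightarrow> 'a \<Rightarrow> real) \<Rightarrow> ('a \<Rightarrow> real) \<Rightarrow> ('a \<Rightarrow> real) \<Rightarrow> 'a \<times> 'a \<Rightarrow> real" where
  "weak_form_integrand p K u \<eta> = (\<lambda>(x, y).
     \<bar>u x - u y\<bar> powr (p - 2) * (u x - u y) * (\<eta> x - \<eta> y) * K x y)"

text \<open>Only \<open>u\<^sub>-\<close>, not \<open>u\<close>, is required to lie in the tail space, so the
  double integral may a priori be \<open>-\<infinity>\<close>; its positive part is always finite. Hence
  nonnegativity of the extended-real integral means integrability together with
  nonnegativity of the Bochner integral. Integrability must be stated, since the
  Bochner integral of a non-integrable function is \<open>0\<close> by convention.\<close>

definition weak_supersolution ::
    "real \<Rightarrow> real \<Rightarrow> (real^'n \<Rightarrow> real^'n \<Rightarrow> real) \<Rightarrow> (real^'n) set \<Rightarrow> (real^'n \<Rightarrow> real) \<Rightarrow> bool" where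
  "weak_supersolution s p K \<Omega> u \<longleftrightarrow>
     u \<in> borel_measurable lebesgue \<and>
     u \<in> Wsp_loc s p \<Omega> \<and>
     (\<lambda>x. max (- u x) 0) \<in> tail_space s p \<and>
     (\<forall>\<eta> \<in> test_functions \<Omega>. (\<forall>x. 0 \<le> \<eta> x) \<longrightarrow>
        integrable lebesgue (weak_form_integrand p K u \<eta>) \<and>
        0 \<le> integral\<^sup>L lebesgue (weak_form_integrand p K u \<eta>))"

end

theory Submission
  imports Defs
begin

text \<open>Write \<open>J t = |t|\<^sup>p\<^sup>-\<^sup>2 t\<close> and let \<open>h\<^sub>e\<close> be the continuous ramp that is \<open>1\<close> up to \<open>k\<close> and
  \<open>0\<close> from \<open>k + e\<close> on. Testing the inequality for \<open>u\<close> with \<open>\<eta> h\<^sub>e(u)\<close> and letting \<open>e \<rightarrow> 0\<close> gives the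
  inequality for \<open>min u k\<close>: pointwise, the integrand for \<open>u\<close> and \<open>\<eta> h\<^sub>e(u)\<close> is at most the integrand for
  \<open>min u k\<close> and \<open>\<eta>\<close>, up to an error dominated by twice the absolute integrand for \<open>u\<close> and \<open>\<eta>\<close> which
  tends to \<open>0\<close>.

  Since \<open>\<phi> = \<eta> h\<^sub>e(u)\<close> is not smooth, one mollifies it. By Fubini, the form at \<open>\<phi> * \<rho>\<close> is the
  \<open>\<rho>\<close>-average of \<open>T z\<close>, the form at the translate \<open>\<phi>(\<cdot> - z)\<close>; hence \<open>T z \<ge> 0\<close> for some
  arbitrarily small \<open>z\<close>. Fatou's lemma carries this over to \<open>z = 0\<close>: the integrands of \<open>T z\<close> are dominated
  by functions whose integral does not depend on \<open>z\<close>, because the Gagliardo seminorm of \<open>\<phi>\<close> is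
  translation invariant, and the integrability of the form at a smooth cutoff controls the
  contribution of pairs of points that are far apart.\<close>

subsection \<open>Smooth functions and convolution\<close>

text \<open>The index \<open>n\<close> closes the family under differentiation: the derivative of
  \<open>flat n\<close> is a combination of \<open>flat (n + 2)\<close> and
  \<open>flat (n + 1)\<close>, so smoothness of exp(-1/t) reduces to computing first
  derivatives.\<close>

definition flat :: "nat \<Rightarrow> real \<Rightarrow> real" where
  "flat n t = (if 0 < t then exp (- (1 / t)) / t ^ n else 0)"

text \<open>With 1/t as the variable, the limit from the right is the decay of a power divided by
  exp at infinity.\<close>

lemma flat_tendsto_0: "(flat n \<longlongrightarrow> 0) (at 0)"
proof -
  have "((\<lambda>t::real. inverse t ^ n / exp (inverse t)) \<longlongrightarrow> 0) (at_right 0)"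
    by (rule filterlim_compose[OF tendsto_power_div_exp_0 filterlim_inverse_at_top_right])
  then have R: "(flat n \<longlongrightarrow> 0) (at_right 0)"
    by (rule Lim_transform_eventually)
       (auto simp: flat_def eventually_at_filter exp_minus field_simps)
  have L: "(flat n \<longlongrightarrow> 0) (at_left 0)"
    by (rule Lim_transform_eventually[OF tendsto_const]) (auto simp: flat_def eventually_at_filter)
  from L R show ?thesis by (simp add: filterlim_split_at_real)
qed

lemma flat_has_derivative:
  "(flat n has_real_derivative (flat (n + 2) t - real n * flat (n + 1) t)) (at t)"
proof (cases t "0 :: real" rule: linorder_cases)
  case greater
  have "((\<lambda>t. exp (- (1 / t)) / t ^ n) has_real_derivative
      (flat (n + 2) t - real n * flat (n + 1) t)) (at t)"
    using greater
    by (auto intro!: derivative_eq_intros simp: flat_def field_simps power2_eq_square)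
       (cases n; simp add: field_simps)
  then show ?thesis
    by (rule has_field_derivative_transform_within_open[where S = "{0<..}"])
       (use greater in \<open>auto simp: flat_def\<close>)
next
  case less
  have "((\<lambda>t. 0) has_real_derivative flat (n + 2) t - real n * flat (n + 1) t) (at t)"
    using less by (simp add: flat_def)
  then show ?thesis
    by (rule has_field_derivative_transform_within_open[where S = "{..<0}"])
       (use less in \<open>auto simp: flat_def\<close>)
next
  case equal
  \<comment> \<open>At 0 the difference quotient is \<open>flat (Suc n)\<close>, which tends to 0;
    both terms of the claimed derivative vanish there.\<close>
  have "((\<lambda>h. flat n h / h) \<longlongrightarrow> 0) (at 0)"
    by (rule Lim_transform_eventually[OF flat_tendsto_0[of "Suc n"]])
       (auto simp: flat_def eventually_at_filter)
  then show ?thesis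
    using equal by (simp add: DERIV_def flat_def)
qed

text \<open>A class of functions that contains the bumps \<open>exp (- 1 / (r - |x|\<^sup>2))\<close> and is closed under taking
  directional derivatives, so that all its members are smooth.\<close>

inductive bump_algebra :: "('a::euclidean_space \<Rightarrow> real) \<Rightarrow> bool" where
  const: "bump_algebra (\<lambda>x. c)"
| inner: "bump_algebra (\<lambda>x. x \<bullet> v)"
| flat: "bump_algebra (\<lambda>x. flat n (r - x \<bullet> x))"
| add: "bump_algebra f \<Longrightarrow> bump_algebra g \<Longrightarrow> bump_algebra (\<lambda>x. f x + g x)"
| mult: "bump_algebra f \<Longrightarrow> bump_algebra g \<Longrightarrow> bump_algebra (\<lambda>x. f x * g x)"

text \<open>Inner products with fixed vectors belong to the class because the chain rule for
  \<open>r - x \<bullet> x\<close> produces them; the sum and product rules then stay inside the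
  class.\<close>

lemma bump_algebra_derivative:
  assumes "bump_algebra f"
  shows "\<exists>f'. (\<forall>x. (f has_derivative f' x) (at x)) \<and> (\<forall>v. bump_algebra (\<lambda>x. f' x v))"
  using assms
proof induction
  case (const c)
  show ?case
    by (rule exI[of _ "\<lambda>x v. 0"]) (auto intro: bump_algebra.const)
next
  case (inner w)
  have "((\<lambda>x. x \<bullet> w) has_derivative (\<lambda>v. v \<bullet> w)) (at x)" for x
    by (auto intro!: derivative_eq_intros)
  then show ?case
    by (intro exI[of _ "\<lambda>x v. v \<bullet> w"]) (auto intro: bump_algebra.const)
next
  case (flat n r)
  let ?f' = "\<lambda>x v. (flat (n + 2) (r - x \<bullet> x) + (- real n) * flat (n + 1) (r - x \<bullet> x))
                * ((x \<bullet> v) * (-2)) :: real"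
  have "((\<lambda>x. flat n (r - x \<bullet> x)) has_derivative ?f' x) (at x)" for x :: 'a
  proof -
    have "((\<lambda>x. r - x \<bullet> x) has_derivative (\<lambda>v. (x \<bullet> v) * (-2))) (at x)"
      by (rule has_derivative_eq_rhs, (rule derivative_intros)+) (simp add: fun_eq_iff inner_commute)
    from DERIV_compose_FDERIV[OF flat_has_derivative this]
    show ?thesis by (rule has_derivative_eq_rhs) (simp add: fun_eq_iff mult.commute)
  qed
  moreover have "bump_algebra (\<lambda>x. ?f' x v)" for v
    by (intro bump_algebra.intros)
  ultimately show ?case by (intro exI[of _ ?f']) auto
next
  case (add f g)
  then obtain f' g' where
    "\<And>x. (f has_derivative f' x) (at x)" "\<And>v. bump_algebra (\<lambda>x. f' x v)"
    "\<And>x. (g has_derivative g' x) (at x)" "\<And>v. bump_algebra (\<lambda>x. g' x v)" by blast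
  then show ?case
    by (intro exI[of _ "\<lambda>x v. f' x v + g' x v"])
       (auto intro!: derivative_intros bump_algebra.add)
next
  case (mult f g)
  then obtain f' g' where
    "\<And>x. (f has_derivative f' x) (at x)" "\<And>v. bump_algebra (\<lambda>x. f' x v)"
    "\<And>x. (g has_derivative g' x) (at x)" "\<And>v. bump_algebra (\<lambda>x. g' x v)" by blast
  then show ?case using mult.hyps
    by (intro exI[of _ "\<lambda>x v. f x * g' x v + f' x v * g x"])
       (auto intro!: has_derivative_mult bump_algebra.add bump_algebra.mult)
qed

lemma bump_algebra_C_diff: "bump_algebra f \<Longrightarrow> C_diff k f"
proof (induction k arbitrary: f)
  case 0
  from bump_algebra_derivative[OF this] show ?case
    by (auto intro!: continuous_at_imp_continuous_on dest: has_derivative_continuous)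
next
  case (Suc k)
  obtain f' where f': "\<And>x. (f has_derivative f' x) (at x)" "\<And>v. bump_algebra (\<lambda>x. f' x v)"
    using bump_algebra_derivative[OF Suc.prems] by blast
  have "frechet_derivative f (at x) = f' x" for x
    using frechet_derivative_at[OF f'(1)] by simp
  then show ?case using f' Suc.IH by (auto simp: differentiable_def)
qed

text \<open>The support is described exactly: strict positivity on the whole ball is what later
  makes a weighted average of negative values strictly negative.\<close>

lemma ex_bump:
  fixes \<delta> :: real
  assumes "0 < \<delta>"
  obtains \<rho> :: "'a::euclidean_space \<Rightarrow> real"
  where "\<And>k. C_diff k \<rho>" "\<And>x. 0 \<le> \<rho> x" "\<And>x. \<rho> x \<noteq> 0 \<longleftrightarrow> norm x < \<delta>"
proof
  let ?\<rho> = "\<lambda>x::'a. flat 0 (\<delta>\<^sup>2 - x \<bullet> x)"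
  show "C_diff k ?\<rho>" for k by (rule bump_algebra_C_diff[OF bump_algebra.flat])
  show "0 \<le> ?\<rho> x" for x by (simp add: flat_def)
  show "?\<rho> x \<noteq> 0 \<longleftrightarrow> norm x < \<delta>" for x
    using assms by (simp add: flat_def dot_square_norm power_strict_mono abs_le_square_iff[symmetric] not_le[symmetric])
qed

section \<open>Uniform estimates for compactly supported functions of class C^1\<close>

lemma C_diff_continuous:
  assumes "C_diff k f"
  shows "continuous_on UNIV f"
proof (cases k)
  case 0
  then show ?thesis using assms by simp
next
  case (Suc m)
  then have "f differentiable (at x)" for x using assms by (simp only: C_diff.simps)
  then show ?thesis
    by (intro continuous_at_imp_continuous_on ballI differentiable_imp_continuous_within)
qed

lemma C_diff_SucD:
  assumes "C_diff (Suc k) f"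
  shows "(f has_derivative frechet_derivative f (at x)) (at x)"
    and "C_diff k (\<lambda>x. frechet_derivative f (at x) v)"
    and "continuous_on UNIV (\<lambda>x. frechet_derivative f (at x) v)"
proof -
  show *: "C_diff k (\<lambda>x. frechet_derivative f (at x) v)" using assms by (simp only: C_diff.simps)
  show "continuous_on UNIV (\<lambda>x. frechet_derivative f (at x) v)" by (rule C_diff_continuous[OF *])
  show "(f has_derivative frechet_derivative f (at x)) (at x)"
    using assms by (simp only: C_diff.simps frechet_derivative_works[symmetric])
qed

lemma frechet_derivative_outside_support:
  fixes f :: "'a::euclidean_space \<Rightarrow> real"
  assumes "\<And>x. R < norm x \<Longrightarrow> f x = 0" "R < norm x"
  shows "frechet_derivative f (at x) v = 0"
proof -
  have "open {x::'a. R < norm x}" by (intro open_Collect_less continuous_intros)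
  have "((\<lambda>y. 0::real) has_derivative (\<lambda>v. 0)) (at x)" by simp
  then have "(f has_derivative (\<lambda>v. 0)) (at x)"
    by (rule has_derivative_transform_within_open[OF _ \<open>open _\<close>]) (use assms in auto)
  from frechet_derivative_at[OF this, symmetric] show ?thesis by simp
qed

lemma continuous_compact_support_bounded:
  fixes f :: "'a::euclidean_space \<Rightarrow> real"
  assumes "continuous_on UNIV f" "\<And>x. R < norm x \<Longrightarrow> f x = 0"
  obtains B where "0 \<le> B" "\<And>x. \<bar>f x\<bar> \<le> B"
proof -
  have "compact (f ` cball 0 R)"
    by (rule compact_continuous_image) (auto intro: continuous_on_subset[OF assms(1)])
  then obtain B where B: "\<forall>y\<in>f ` cball 0 R. norm y \<le> B"
    using compact_imp_bounded bounded_iff by metis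
  have "\<bar>f x\<bar> \<le> max B 0" for x
    using B assms(2)[of x] by (cases "norm x \<le> R") (auto simp: max_def dest!: bspec)
  then show ?thesis using that[of "max B 0"] by auto
qed

lemma continuous_compact_support_uniform:
  fixes f :: "'a::euclidean_space \<Rightarrow> real"
  assumes "continuous_on UNIV f" "\<And>x. R < norm x \<Longrightarrow> f x = 0" "0 < e"
  obtains d where "0 < d" "\<And>x y. dist x y < d \<Longrightarrow> \<bar>f x - f y\<bar> < e"
proof -
  have "uniformly_continuous_on (cball 0 (R + 1)) f"
    by (intro compact_uniformly_continuous continuous_on_subset[OF assms(1)]) auto
  then obtain d where d: "0 < d"
    "\<And>x y. x \<in> cball 0 (R + 1) \<Longrightarrow> y \<in> cball 0 (R + 1) \<Longrightarrow> dist y x < d \<Longrightarrow> dist (f y) (f x) < e"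
    using \<open>0 < e\<close> unfolding uniformly_continuous_on_def by metis
  \<comment> \<open>Capping the distance by 1 handles pairs in which a point leaves the ball of
    radius \<open>R + 1\<close>: both points are then outside radius \<open>R\<close>, where
    \<open>f\<close> vanishes.\<close>
  have "\<bar>f x - f y\<bar> < e" if "dist x y < min d 1" for x y
  proof (cases "norm x \<le> R + 1 \<and> norm y \<le> R + 1")
    case True
    then show ?thesis using d(2)[of y x] that by (auto simp: dist_real_def)
  next
    case False
    have "norm x \<le> norm y + dist x y" "norm y \<le> norm x + dist x y"
      by (metis add.commute dist_commute dist_norm norm_triangle_sub)+
    then have "R < norm x" "R < norm y" using False that by auto
    then show ?thesis using assms by simp
  qed
  then show ?thesis using that[of "min d 1"] d(1) by auto
qed

text \<open>\<open>C_diff\<close> speaks about derivatives in fixed directions. Expanding in the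
  basis turns bounds in finitely many directions into a bound on the operator norm.\<close>

lemma abs_linear_le_sum_Basis:
  fixes f :: "'a::euclidean_space \<Rightarrow> real"
  assumes "linear f"
  shows "\<bar>f h\<bar> \<le> norm h * (\<Sum>b\<in>Basis. \<bar>f b\<bar>)"
proof -
  have "f h = (\<Sum>b\<in>Basis. (h \<bullet> b) * f b)"
    by (subst euclidean_representation[of h, symmetric])
       (simp add: linear_sum[OF assms] linear_cmul[OF assms])
  also have "\<bar>\<dots>\<bar> \<le> (\<Sum>b\<in>Basis. \<bar>h \<bullet> b\<bar> * \<bar>f b\<bar>)"
    by (rule order_trans[OF sum_abs]) (simp add: abs_mult)
  also have "\<dots> \<le> (\<Sum>b\<in>Basis. norm h * \<bar>f b\<bar>)"
    by (intro sum_mono mult_right_mono Basis_le_norm) auto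
  finally show ?thesis by (simp add: sum_distrib_left)
qed

lemma C1_compact_support_lipschitz:
  fixes f :: "'a::euclidean_space \<Rightarrow> real"
  assumes "C_diff (Suc k) f" "\<And>x. R < norm x \<Longrightarrow> f x = 0"
  obtains L where "0 \<le> L" "\<And>x y. \<bar>f x - f y\<bar> \<le> L * norm (x - y)"
proof -
  let ?D = "\<lambda>x. frechet_derivative f (at x)"
  note D = C_diff_SucD[OF assms(1)]
  have "\<exists>B. 0 \<le> B \<and> (\<forall>x. \<bar>?D x b\<bar> \<le> B)" for b
    by (rule continuous_compact_support_bounded[OF D(3)[of b], of R])
       (auto intro: frechet_derivative_outside_support[OF assms(2)])
  then obtain B where B: "\<And>b. 0 \<le> B b" "\<And>b x. \<bar>?D x b\<bar> \<le> B b" by metis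
  have "onorm (?D x) \<le> (\<Sum>b\<in>Basis. B b)" for x
  proof (rule onorm_le)
    fix h
    have "\<bar>?D x h\<bar> \<le> norm h * (\<Sum>b\<in>Basis. \<bar>?D x b\<bar>)"
      by (intro abs_linear_le_sum_Basis has_derivative_linear[OF D(1)])
    also have "\<dots> \<le> norm h * (\<Sum>b\<in>Basis. B b)"
      by (intro mult_left_mono sum_mono B) auto
    finally show "norm (?D x h) \<le> (\<Sum>b\<in>Basis. B b) * norm h" by (simp add: mult.commute)
  qed
  then have "norm (f x - f y) \<le> (\<Sum>b\<in>Basis. B b) * norm (x - y)" for x y
    by (intro differentiable_bound[of UNIV f ?D] D(1)) auto
  then show ?thesis using that[of "\<Sum>b\<in>Basis. B b"] B by (auto intro: sum_nonneg)
qed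

text \<open>The error bound is uniform in \<open>x\<close>, so it can be integrated against a merely
  integrable factor when a convolution is differentiated. It follows from the mean value inequality
  and the uniform continuity of the finitely many partial derivatives.\<close>

lemma C1_compact_support_uniform_linearization:
  fixes f :: "'a::euclidean_space \<Rightarrow> real"
  assumes "C_diff (Suc k) f" "\<And>x. R < norm x \<Longrightarrow> f x = 0" "0 < e"
  obtains d where "0 < d"
    "\<And>x h. norm h < d \<Longrightarrow> \<bar>f (x + h) - f x - frechet_derivative f (at x) h\<bar> \<le> e * norm h"
proof -
  let ?D = "\<lambda>x. frechet_derivative f (at x)"
  note D = C_diff_SucD[OF assms(1)]
  \<comment> \<open>The error \<open>e\<close> is shared equally among the basis vectors.\<close>
  define e' where "e' = e / real DIM('a)"
  have "0 < e'" using \<open>0 < e\<close> by (simp add: e'_def)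
  then have "\<exists>d. 0 < d \<and> (\<forall>x y. dist x y < d \<longrightarrow> \<bar>?D x b - ?D y b\<bar> < e')" for b
    by - (rule continuous_compact_support_uniform[OF D(3)[of b], of R e'],
          auto intro: frechet_derivative_outside_support[OF assms(2)])
  then obtain d where d: "\<And>b. 0 < d b"
    "\<And>b x y. dist x y < d b \<Longrightarrow> \<bar>?D x b - ?D y b\<bar> < e'" by metis
  define d0 where "d0 = Min (d ` Basis)"
  have d0: "0 < d0" "\<And>b. b \<in> Basis \<Longrightarrow> d0 \<le> d b" using d(1) by (auto simp: d0_def)
  have "\<bar>f (x + h) - f x - ?D x h\<bar> \<le> e * norm h" if h: "norm h < d0" for x h
  proof -
    have on: "onorm (?D y - ?D x) \<le> e" if "y \<in> ball x d0" for y
    proof (rule onorm_le)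
      fix v
      have "\<bar>(?D y - ?D x) v\<bar> \<le> norm v * (\<Sum>b\<in>Basis. \<bar>(?D y - ?D x) b\<bar>)"
        unfolding fun_diff_def
        by (intro abs_linear_le_sum_Basis linear_compose_sub has_derivative_linear[OF D(1)])
      also have "\<dots> \<le> norm v * (\<Sum>b\<in>(Basis::'a set). e')"
        using that d0 by (intro mult_left_mono sum_mono)
          (auto intro!: less_imp_le[OF d(2)] simp: dist_commute fun_diff_def less_le_trans)
      finally show "norm ((?D y - ?D x) v) \<le> e * norm v" by (simp add: e'_def mult.commute)
    qed
    have "norm (f (x + h) - f x - ?D x (x + h - x)) \<le> norm (x + h - x) * e"
    proof (rule differentiable_bound_linearization[where S = "ball x d0"])
      fix t :: real assume t: "t \<in> {0..1}"
      then have "\<bar>t\<bar> * norm h \<le> 1 * norm h" by (intro mult_right_mono) auto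
      then show "x + t *\<^sub>R (x + h - x) \<in> ball x d0" using h by (simp add: dist_norm)
    qed (use on d0 in \<open>auto intro!: has_derivative_at_withinI D(1)\<close>)
    then show ?thesis by (simp add: mult.commute)
  qed
  then show ?thesis using that d0(1) by blast
qed

lemma integrable_mult_bounded:
  fixes f g :: "'a \<Rightarrow> real"
  assumes "integrable M f" "g \<in> borel_measurable M" "\<And>x. \<bar>g x\<bar> \<le> B"
  shows "integrable M (\<lambda>x. f x * g x)"
proof (rule Bochner_Integration.integrable_bound[of M "\<lambda>x. B * f x"])
  show "AE x in M. norm (f x * g x) \<le> norm (B * f x)"
  proof (intro AE_I2)
    fix x
    have "\<bar>f x\<bar> * \<bar>g x\<bar> \<le> \<bar>f x\<bar> * \<bar>B\<bar>" using assms(3)[of x] by (intro mult_left_mono) auto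
    then show "norm (f x * g x) \<le> norm (B * f x)" by (simp add: abs_mult mult.commute)
  qed
qed (use assms in auto)

section \<open>Convolution with a smooth kernel is smooth\<close>

definition conv :: "('a::euclidean_space \<Rightarrow> real) \<Rightarrow> ('a \<Rightarrow> real) \<Rightarrow> 'a \<Rightarrow> real" where
  "conv f \<rho> x = (\<integral>y. f y * \<rho> (x - y) \<partial>lborel)"

lemma conv_integrable:
  fixes f \<rho> :: "'a::euclidean_space \<Rightarrow> real"
  assumes "integrable lborel f" "continuous_on UNIV \<rho>" "\<And>x. R < norm x \<Longrightarrow> \<rho> x = 0"
  shows "integrable lborel (\<lambda>y. f y * \<rho> (x - y))"
proof -
  obtain B where "\<And>x. \<bar>\<rho> x\<bar> \<le> B"
    using continuous_compact_support_bounded[OF assms(2,3)] by blast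
  moreover have [measurable]: "\<rho> \<in> borel_measurable borel"
    using assms(2) by (rule borel_measurable_continuous_onI)
  ultimately show ?thesis
    by (intro integrable_mult_bounded[where B = B] assms(1)) auto
qed

text \<open>All derivatives fall on \<open>\<rho>\<close>: the derivative in direction
  \<open>v\<close> is again a convolution, with the directional derivative of \<open>\<rho>\<close>.
  The induction therefore runs over arbitrary \<open>\<rho>\<close>, and each step integrates a
  uniform estimate for \<open>\<rho>\<close> against |f|.\<close>

lemma conv_C_diff:
  fixes f \<rho> :: "'a::euclidean_space \<Rightarrow> real"
  assumes f: "integrable lborel f"
    and "C_diff k \<rho>" "\<And>x. R < norm x \<Longrightarrow> \<rho> x = 0"
  shows "C_diff k (conv f \<rho>)"
  using assms(2,3)
proof (induction k arbitrary: \<rho>)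
  case 0
  then have cont: "continuous_on UNIV \<rho>" by simp
  note int = conv_integrable[OF f cont 0(2)]
  \<comment> \<open>\<open>N\<close> may be 0, hence the denominators \<open>N + 1\<close>
    below.\<close>
  define N where "N = (\<integral>y. \<bar>f y\<bar> \<partial>lborel)"
  have N: "0 \<le> N" by (simp add: N_def)
  have "continuous_on UNIV (conv f \<rho>)"
    unfolding continuous_on_iff
  proof (intro ballI allI impI)
    fix x :: 'a and e :: real assume "0 < e"
    then have "0 < e / (N + 1)" using N by simp
    then obtain d where d: "0 < d" "\<And>x y. dist x y < d \<Longrightarrow> \<bar>\<rho> x - \<rho> y\<bar> < e / (N + 1)"
      using continuous_compact_support_uniform[OF cont 0(2)] by metis
    have "dist (conv f \<rho> x') (conv f \<rho> x) < e" if "dist x' x < d" for x'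
    proof -
      have "conv f \<rho> x' - conv f \<rho> x = (\<integral>y. f y * \<rho> (x' - y) - f y * \<rho> (x - y) \<partial>lborel)"
        unfolding conv_def by (simp add: int)
      also have "\<bar>\<dots>\<bar> \<le> (\<integral>y. \<bar>f y\<bar> * (e / (N + 1)) \<partial>lborel)"
      proof (rule order_trans[OF integral_abs_bound], rule integral_mono)
        fix y
        have "\<bar>f y\<bar> * \<bar>\<rho> (x' - y) - \<rho> (x - y)\<bar> \<le> \<bar>f y\<bar> * (e / (N + 1))"
          using that by (intro mult_left_mono less_imp_le[OF d(2)]) (auto simp: dist_norm)
        then show "\<bar>f y * \<rho> (x' - y) - f y * \<rho> (x - y)\<bar> \<le> \<bar>f y\<bar> * (e / (N + 1))"
          by (simp add: abs_mult right_diff_distrib[symmetric])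
      qed (use int f in auto)
      also have "\<dots> = N * (e / (N + 1))" by (simp add: N_def)
      also have "\<dots> < e" using N \<open>0 < e\<close> by (simp add: field_simps)
      finally show ?thesis by (simp add: dist_real_def)
    qed
    then show "\<exists>d>0. \<forall>x'\<in>UNIV. dist x' x < d \<longrightarrow> dist (conv f \<rho> x') (conv f \<rho> x) < e"
      using d(1) by blast
  qed
  then show ?case by simp
next
  case (Suc k)
  let ?D = "\<lambda>x. frechet_derivative \<rho> (at x)"
  note D = C_diff_SucD[OF Suc.prems(1)]
  note lin = has_derivative_linear[OF D(1)]
  have supp: "\<And>v x. R < norm x \<Longrightarrow> ?D x v = 0"
    by (rule frechet_derivative_outside_support[OF Suc.prems(2)])
  note int = conv_integrable[OF f C_diff_continuous[OF Suc.prems(1)] Suc.prems(2)]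
  note intD = conv_integrable[OF f D(3) supp]
  define N where "N = (\<integral>y. \<bar>f y\<bar> \<partial>lborel)"
  have N: "0 \<le> N" by (simp add: N_def)
  have der: "(conv f \<rho> has_derivative (\<lambda>v. conv f (\<lambda>x. ?D x v) x)) (at x)" for x
    unfolding has_derivative_at_alt
  proof (intro conjI allI impI)
    show "bounded_linear (\<lambda>v. conv f (\<lambda>x. ?D x v) x)"
      unfolding linear_conv_bounded_linear[symmetric] conv_def
      by (rule linearI)
         (simp_all add: linear_add[OF lin] linear_cmul[OF lin] distrib_left intD
           mult.left_commute[of _ "_::real"])
    fix e :: real assume "0 < e"
    then have "0 < e / (N + 1)" using N by simp
    then obtain d where d: "0 < d" "\<And>x h. norm h < d \<Longrightarrow> \<bar>\<rho> (x + h) - \<rho> x - ?D x h\<bar> \<le> e / (N + 1) * norm h"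
      using C1_compact_support_uniform_linearization[OF Suc.prems] by metis
    have "norm (conv f \<rho> y - conv f \<rho> x - conv f (\<lambda>z. ?D z (y - x)) x) \<le> e * norm (y - x)"
      if "norm (y - x) < d" for y
    proof -
      have "conv f \<rho> y - conv f \<rho> x - conv f (\<lambda>z. ?D z (y - x)) x
        = (\<integral>z. f z * \<rho> (y - z) - f z * \<rho> (x - z) - f z * ?D (x - z) (y - x) \<partial>lborel)"
        unfolding conv_def by (simp add: int intD)
      also have "\<bar>\<dots>\<bar> \<le> (\<integral>z. \<bar>f z\<bar> * (e / (N + 1) * norm (y - x)) \<partial>lborel)"
      proof (rule order_trans[OF integral_abs_bound], rule integral_mono)
        fix z
        have "\<bar>f z\<bar> * \<bar>\<rho> (x - z + (y - x)) - \<rho> (x - z) - ?D (x - z) (y - x)\<bar>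
            \<le> \<bar>f z\<bar> * (e / (N + 1) * norm (y - x))"
          using that by (intro mult_left_mono d(2)) auto
        then show "\<bar>f z * \<rho> (y - z) - f z * \<rho> (x - z) - f z * ?D (x - z) (y - x)\<bar>
            \<le> \<bar>f z\<bar> * (e / (N + 1) * norm (y - x))"
          by (simp add: abs_mult right_diff_distrib[symmetric])
      qed (use int intD f in auto)
      also have "\<dots> = N / (N + 1) * (e * norm (y - x))" by (simp add: N_def)
      also have "\<dots> \<le> 1 * (e * norm (y - x))" using N \<open>0 < e\<close>
        by (intro mult_right_mono) (auto simp: field_simps)
      finally show ?thesis by simp
    qed
    then show "\<exists>d>0. \<forall>y. norm (y - x) < d \<longrightarrow>
        norm (conv f \<rho> y - conv f \<rho> x - conv f (\<lambda>z. ?D z (y - x)) x) \<le> e * norm (y - x)"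
      using d(1) by blast
  qed
  have "frechet_derivative (conv f \<rho>) (at x) = (\<lambda>v. conv f (\<lambda>x. ?D x v) x)" for x
    using frechet_derivative_at[OF der] by simp
  moreover have "C_diff k (conv f (\<lambda>x. ?D x v))" for v
    by (intro Suc.IH supp D(2))
  ultimately show ?case using der by (auto simp: differentiable_def)
qed

subsection \<open>Gagliardo integrals and translations\<close>

text \<open>The function is dominated by the sum of \<open>c k\<close> times the indicator of the
  ball of radius \<open>r k\<close>, and the volume of such a ball scales like
  \<open>r k ^ DIM('a)\<close>. This replaces polar coordinates, both near 0 and at
  infinity.\<close>

lemma integrable_ball_cover:
  fixes f :: "'a::euclidean_space \<Rightarrow> real"
  assumes [measurable]: "f \<in> borel_measurable borel"
    and "\<And>k. 0 \<le> c k" "\<And>k. 0 \<le> r k"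
    and sm: "summable (\<lambda>k. c k * r k ^ DIM('a))"
    and cover: "\<And>x. f x \<noteq> 0 \<Longrightarrow> \<exists>k. norm x < r k \<and> \<bar>f x\<bar> \<le> c k"
  shows "integrable lborel f"
proof (rule integrableI_bounded)
  let ?V = "unit_ball_vol (real DIM('a))"
  have [measurable]: "ball (0::'a) (r k) \<in> sets borel" for k by simp
  have "(\<integral>\<^sup>+x. norm (f x) \<partial>lborel) \<le> (\<integral>\<^sup>+x. (\<Sum>k. ennreal (c k) * indicator (ball (0::'a) (r k)) x) \<partial>lborel)"
  proof (intro nn_integral_mono)
    fix x
    show "ennreal (norm (f x)) \<le> (\<Sum>k. ennreal (c k) * indicator (ball (0::'a) (r k)) x)"
    proof (cases "f x = 0")
      case False
      then obtain k where k: "norm x < r k" "\<bar>f x\<bar> \<le> c k" using cover by blast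
      then have "ennreal (norm (f x)) \<le> (\<Sum>k\<in>{k}. ennreal (c k) * indicator (ball (0::'a) (r k)) x)"
        by (simp add: ennreal_leI)
      also have "\<dots> \<le> (\<Sum>k. ennreal (c k) * indicator (ball (0::'a) (r k)) x)"
        by (rule sum_le_suminf) auto
      finally show ?thesis .
    qed simp
  qed
  also have "\<dots> = (\<Sum>k. ennreal (c k) * emeasure lborel (ball (0::'a) (r k)))"
    by (subst nn_integral_suminf) (auto simp: nn_integral_cmult_indicator)
  also have "\<dots> = (\<Sum>k. ennreal (?V * (c k * r k ^ DIM('a))))"
    using assms(2,3) by (simp add: emeasure_ball ennreal_mult' [symmetric] mult_ac)
  also have "\<dots> < \<infinity>"
    using assms(2,3) summable_mult[OF sm, of ?V]
    by (subst suminf_ennreal2) auto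
  finally show "(\<integral>\<^sup>+x. norm (f x) \<partial>lborel) < \<infinity>" .
qed simp

lemma ex_dyadic:
  fixes y :: real
  assumes "1 \<le> y"
  obtains k where "2 ^ k \<le> y" "y < 2 ^ Suc k"
proof -
  obtain m where "y < 2 ^ m" using real_arch_pow[of 2 y] by auto
  define j where "j = (LEAST m. y < 2 ^ m)"
  have j: "y < 2 ^ j" unfolding j_def by (rule LeastI) fact
  then obtain k where k: "j = Suc k" using assms by (cases j) auto
  then have "\<not> y < 2 ^ k" using not_less_Least[of k "\<lambda>m. y < 2 ^ m"] by (auto simp: j_def)
  then show ?thesis using that[of k] j k by auto
qed

text \<open>The shells 2^k <= 1 + |x| < 2^(k+1) contribute terms that are geometric in
  \<open>k\<close> with ratio 2^(-a). For a = sp this is the weight of the tail space.\<close>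

lemma integrable_one_plus_norm_powr:
  fixes a :: real
  assumes "0 < a"
  shows "integrable lborel (\<lambda>x::'a::euclidean_space. (1 + norm x) powr (- real DIM('a) - a))"
proof (rule integrable_ball_cover[where r = "\<lambda>k. 2 ^ Suc k" and c = "\<lambda>k. (2 ^ k) powr (- real DIM('a) - a)"])
  let ?n = "DIM('a)"
  have eq: "(2 ^ k) powr (- real ?n - a) * (2 ^ Suc k) ^ ?n = 2 ^ ?n * (2 powr - a) ^ k" for k
  proof -
    have "(2 ^ k :: real) powr (- real ?n - a) = 2 powr (- (real k * a)) / (2 ^ k) ^ ?n"
      by (simp add: powr_realpow[symmetric] powr_powr powr_diff[symmetric] algebra_simps)
         (rule arg_cong[where f = "(powr) 2"], linarith)
    moreover have "(2 powr - a) ^ k = (2::real) powr (- (real k * a))"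
      by (simp add: powr_realpow[symmetric] powr_powr mult.commute)
    ultimately show ?thesis by (simp add: power_mult_distrib)
  qed
  show "summable (\<lambda>k. (2 ^ k) powr (- real ?n - a) * (2 ^ Suc k) ^ ?n :: real)"
    unfolding eq using assms by (intro summable_mult summable_geometric) (simp add: powr_minus_divide)
  fix x :: 'a
  obtain k where k: "2 ^ k \<le> 1 + norm x" "1 + norm x < 2 ^ Suc k"
    using ex_dyadic[of "1 + norm x"] by auto
  then have "(1 + norm x) powr (- real ?n - a) \<le> (2 ^ k) powr (- real ?n - a)"
    using assms by (intro powr_mono2') auto
  then show "\<exists>k. norm x < 2 ^ Suc k \<and> \<bar>(1 + norm x) powr (- real ?n - a)\<bar> \<le> (2 ^ k) powr (- real ?n - a)"
    using k by (intro exI[of _ k]) auto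
qed auto

text \<open>Here the dyadic shells shrink to the origin; they come from applying
  \<open>ex_dyadic\<close> to 1 / |x|.\<close>

lemma integrable_norm_powr_near_0:
  fixes a :: real
  assumes "0 < a"
  shows "integrable lborel
    (\<lambda>x::'a::euclidean_space. indicator (ball 0 1) x * norm x powr (a - real DIM('a)))"
proof (rule integrable_ball_cover[where r = "\<lambda>k. 2 / 2 ^ k" and c = "\<lambda>k. (2 powr - a) ^ k * (2 ^ Suc k) ^ DIM('a)"])
  let ?n = "DIM('a)"
  have eq: "(2 powr - a) ^ k * (2 ^ Suc k) ^ ?n * (2 / 2 ^ k) ^ ?n = 4 ^ ?n * (2 powr - a) ^ k" for k
    by (simp add: power_divide power_mult_distrib power_mult[symmetric] flip: power_mult_distrib)
  show "summable (\<lambda>k. (2 powr - a) ^ k * (2 ^ Suc k) ^ ?n * (2 / 2 ^ k) ^ ?n)"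
    unfolding eq using assms by (intro summable_mult summable_geometric) (simp add: powr_minus_divide)
  fix x :: 'a
  assume "indicator (ball 0 1) x * norm x powr (a - real ?n) \<noteq> 0"
  then have x: "0 < norm x" "norm x < 1" by (auto simp: indicator_def split: if_splits)
  then obtain k where k: "2 ^ k \<le> 1 / norm x" "1 / norm x < 2 ^ Suc k"
    using ex_dyadic[of "1 / norm x"] by auto
  have le: "norm x \<le> 1 / 2 ^ k" and ge: "1 / 2 ^ Suc k < norm x"
    using k x by (simp_all add: field_simps)
  \<comment> \<open>The power is split because a - n may have either sign: the upper bound of the
    shell serves the numerator, the lower bound the denominator.\<close>
  have "norm x powr (a - real ?n) = norm x powr a / norm x ^ ?n"
    using x by (simp add: powr_diff powr_realpow)
  also have "\<dots> \<le> (1 / 2 ^ k) powr a / (1 / 2 ^ Suc k) ^ ?n"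
    using x assms by (intro frac_le powr_mono2 power_mono le less_imp_le[OF ge]) auto
  also have "(1 / 2 ^ k :: real) powr a = (2 powr - a) ^ k"
    by (simp add: powr_divide powr_powr powr_realpow[symmetric] powr_minus_divide power_divide mult.commute)
  finally have "norm x powr (a - real ?n) \<le> (2 powr - a) ^ k * (2 ^ Suc k) ^ ?n"
    by (simp add: power_one_over divide_simps)
  moreover have "norm x < 2 / 2 ^ k"
    using le by (rule le_less_trans) (simp add: divide_strict_right_mono)
  ultimately show "\<exists>k. norm x < 2 / 2 ^ k \<and>
      \<bar>indicator (ball 0 1) x * norm x powr (a - real ?n)\<bar> \<le> (2 powr - a) ^ k * (2 ^ Suc k) ^ ?n"
    using x by (intro exI[of _ k]) (auto simp: indicator_def)
next
  have [measurable]: "ball (0::'a) 1 \<in> sets borel" by simp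
  show "(\<lambda>x::'a. indicator (ball 0 1) x * norm x powr (a - real DIM('a))) \<in> borel_measurable borel"
    by measurable
qed auto

text \<open>Near 0 the integrand is |z|^(p - sp - n), integrable because s < 1; away from 0 it is
  |z|^(-n - sp), integrable because s > 0.\<close>

lemma integrable_min_norm_kernel:
  fixes s p :: real
  assumes "0 < s" "s < 1" "0 < p"
  shows "integrable lborel
    (\<lambda>z::'a::euclidean_space. min 1 (norm z) powr p / norm z powr (real DIM('a) + s * p))"
proof (rule Bochner_Integration.integrable_bound)
  let ?n = "real DIM('a)"
  have a: "0 < p - s * p" using assms by (simp add: mult_less_cancel_right1 algebra_simps)
  have b: "0 < s * p" using assms by simp
  show "integrable lborel (\<lambda>z::'a. indicator (ball 0 1) z * norm z powr (p - s * p - ?n)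
      + 2 powr (?n + s * p) * (1 + norm z) powr (- ?n - s * p))"
    by (intro Bochner_Integration.integrable_add integrable_norm_powr_near_0[OF a]
          integrable_mult_right integrable_one_plus_norm_powr[OF b])
  show "AE z::'a in lborel. norm (min 1 (norm z) powr p / norm z powr (?n + s * p))
      \<le> norm (indicator (ball 0 1) z * norm z powr (p - s * p - ?n)
      + 2 powr (?n + s * p) * (1 + norm z) powr (- ?n - s * p))"
  proof (intro AE_I2)
    fix z :: 'a
    let ?A = "indicator (ball 0 1) z * norm z powr (p - s * p - ?n)"
    let ?B = "2 powr (?n + s * p) * (1 + norm z) powr (- ?n - s * p)"
    have "min 1 (norm z) powr p / norm z powr (?n + s * p) \<le> ?A + ?B"
    proof (cases "norm z < 1")
      case True
      have "min 1 (norm z) powr p / norm z powr (?n + s * p) = ?A"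
        using True by (simp add: powr_diff[symmetric] algebra_simps)
      also have "\<dots> \<le> ?A + ?B" by simp
      finally show ?thesis .
    next
      case False
      have "((1 + norm z) / 2) powr (?n + s * p) \<le> norm z powr (?n + s * p)"
        using False b by (intro powr_mono2) auto
      then have "1 / norm z powr (?n + s * p) \<le> 1 / ((1 + norm z) / 2) powr (?n + s * p)"
        using False by (intro divide_left_mono mult_pos_pos) (auto simp: add_pos_nonneg)
      also have "\<dots> = ?B"
        by (simp add: powr_divide powr_minus_divide[of _ "?n + s * p", simplified])
      finally show ?thesis using False by (simp add: min_def)
    qed
    moreover have "0 \<le> ?A + ?B" by simp
    ultimately show "norm (min 1 (norm z) powr p / norm z powr (?n + s * p)) \<le> norm (?A + ?B)"
      by simp
  qed
qed simp

section \<open>Translation invariance and Gagliardo integrals of Lipschitz functions\<close>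

lemma nn_integral_lborel_shift:
  fixes c :: "'a::euclidean_space" and f :: "'a \<Rightarrow> ennreal"
  assumes "f \<in> borel_measurable borel"
  shows "(\<integral>\<^sup>+x. f (x - c) \<partial>lborel) = (\<integral>\<^sup>+x. f x \<partial>lborel)"
proof -
  have "(\<integral>\<^sup>+x. f x \<partial>lborel) = (\<integral>\<^sup>+x. f x \<partial>distr lborel borel ((+) (- c)))"
    by (simp add: lborel_distr_plus)
  also have "\<dots> = (\<integral>\<^sup>+x. f (x - c) \<partial>lborel)"
    using assms by (subst nn_integral_distr) auto
  finally show ?thesis by simp
qed

lemma integrable_lborel_shift:
  fixes c :: "'a::euclidean_space" and f :: "'a \<Rightarrow> real"
  assumes f: "integrable lborel f"
  shows "integrable lborel (\<lambda>x. f (x - c))" "(\<integral>x. f (x - c) \<partial>lborel) = (\<integral>x. f x \<partial>lborel)"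
proof -
  have [measurable]: "f \<in> borel_measurable borel" using borel_measurable_integrable[OF f] by simp
  have eq: "lborel = distr lborel borel ((+) (- c))" by (simp add: lborel_distr_plus)
  show "integrable lborel (\<lambda>x. f (x - c))"
    using f by (subst (asm) eq, subst (asm) integrable_distr_eq) auto
  show "(\<integral>x. f (x - c) \<partial>lborel) = (\<integral>x. f x \<partial>lborel)"
    by (subst (2) eq, subst integral_distr) auto
qed

text \<open>By Tonelli, the integral over \<open>y\<close> does not depend on \<open>x\<close>,
  which leaves the measure of \<open>B\<close> as a factor. Evenness of \<open>\<kappa>\<close>
  turns x - y into a shift of \<open>y\<close>.\<close>

lemma integrable_indicator_times_translate:
  fixes \<kappa> :: "'a::euclidean_space \<Rightarrow> real"
  assumes \<kappa>: "integrable lborel \<kappa>" and "\<And>z. \<kappa> (- z) = \<kappa> z"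
    and [measurable]: "B \<in> sets borel" and fin: "emeasure lborel B < \<infinity>"
  shows "integrable lborel (\<lambda>(x, y). indicator B x * \<kappa> (x - y) :: real)"
proof (rule integrableI_bounded)
  have [measurable]: "\<kappa> \<in> borel_measurable borel" using borel_measurable_integrable[OF \<kappa>] by simp
  show "(\<lambda>(x, y). indicator B x * \<kappa> (x - y) :: real) \<in> borel_measurable lborel" 
    by (simp add: lborel_prod[symmetric])
  define N where "N = (\<integral>\<^sup>+z. norm (\<kappa> z) \<partial>lborel)"
  have N: "N < \<infinity>" using \<kappa> by (simp add: integrable_iff_bounded N_def)
  have "(\<integral>\<^sup>+z. norm (case z of (x, y) \<Rightarrow> indicator B x * \<kappa> (x - y)) \<partial>(lborel \<Otimes>\<^sub>M lborel))
    = (\<integral>\<^sup>+x. \<integral>\<^sup>+y. indicator B x * ennreal (norm (\<kappa> (y - x))) \<partial>lborel \<partial>lborel)"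
    using assms(2)[of "_ - _"]
    by (subst lborel.nn_integral_fst[symmetric])
       (auto intro!: nn_integral_cong simp: abs_mult ennreal_mult' indicator_def)
  also have "\<dots> = (\<integral>\<^sup>+x. indicator B x * N \<partial>lborel)"
    by (simp add: nn_integral_cmult nn_integral_lborel_shift[of "\<lambda>y. ennreal \<bar>\<kappa> y\<bar>"] N_def)
  also have "\<dots> = N * emeasure lborel B" by (simp add: nn_integral_cmult_indicator mult.commute)
  also have "\<dots> < \<infinity>" using N fin by (simp add: ennreal_mult_less_top)
  finally show "(\<integral>\<^sup>+z. norm (case z of (x, y) \<Rightarrow> indicator B x * \<kappa> (x - y)) \<partial>lborel) < \<infinity>"
    by (simp add: lborel_prod)
qed

lemma integrable_swap_lborel:
  fixes f :: "'a::euclidean_space \<times> 'a \<Rightarrow> real"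
  assumes "integrable lborel f"
  shows "integrable lborel (\<lambda>(x, y). f (y, x))"
  using lborel_pair.integrable_product_swap[of f] assms by (simp add: lborel_prod)

text \<open>The increment of \<open>\<eta>\<close> is at most a constant times min(1, |x - y|) and
  vanishes unless one of the points lies in the ball. Two copies of the kernel bound, one with the
  variables swapped, therefore dominate.\<close>

lemma integrable_gagliardo_lipschitz:
  fixes \<eta> :: "'a::euclidean_space \<Rightarrow> real" and s p :: real
  assumes sp: "0 < s" "s < 1" "0 < p"
    and lip: "\<And>x y. \<bar>\<eta> x - \<eta> y\<bar> \<le> L * norm (x - y)" and bd: "\<And>x. \<bar>\<eta> x\<bar> \<le> M"
    and supp: "\<And>x. R < norm x \<Longrightarrow> \<eta> x = 0"
  shows "integrable lborel (\<lambda>(x, y). \<bar>\<eta> x - \<eta> y\<bar> powr p / norm (x - y) powr (real DIM('a) + s * p))"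
proof -
  let ?\<kappa> = "\<lambda>z::'a. min 1 (norm z) powr p / norm z powr (real DIM('a) + s * p)"
  let ?B = "cball (0::'a) R"
  \<comment> \<open>\<open>L\<close> serves pairs at distance below 1, and \<open>2 * M\<close>
    serves the others.\<close>
  define C where "C = max L (2 * M)"
  have "0 \<le> M" using bd[of 0] by linarith
  then have C: "0 \<le> C" by (simp add: C_def)
  have min: "\<bar>\<eta> x - \<eta> y\<bar> \<le> C * min 1 (norm (x - y))" for x y
  proof (cases "norm (x - y) < 1")
    case True
    then have "\<bar>\<eta> x - \<eta> y\<bar> \<le> C * norm (x - y)"
      using order_trans[OF lip[of x y] mult_right_mono[of L C "norm (x - y)"]] by (simp add: C_def)
    then show ?thesis using True by simp
  next
    case False
    have "\<bar>\<eta> x - \<eta> y\<bar> \<le> 2 * M" using bd[of x] bd[of y] by linarith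
    also have "\<dots> \<le> C" by (simp add: C_def)
    finally show ?thesis using False by (simp add: min_def)
  qed
  have \<kappa>: "integrable lborel (\<lambda>(x, y). indicator ?B x * ?\<kappa> (x - y))"
    by (intro integrable_indicator_times_translate integrable_min_norm_kernel sp)
       (auto simp: emeasure_lborel_cball_finite[unfolded infinity_ennreal_def])
  have "(max L 0)-lipschitz_on UNIV \<eta>"
    by (rule lipschitz_onI)
       (auto simp: dist_norm intro!: order_trans[OF lip] mult_right_mono)
  then have "continuous_on UNIV \<eta>" by (rule lipschitz_on_continuous_on)
  then have [measurable]: "\<eta> \<in> borel_measurable borel" by (rule borel_measurable_continuous_onI)
  show ?thesis
  proof (rule Bochner_Integration.integrable_bound)
    show "integrable lborel (\<lambda>z. C powr p * ((\<lambda>(x, y). indicator ?B x * ?\<kappa> (x - y)) z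
        + (case z of (x, y) \<Rightarrow> (\<lambda>(x, y). indicator ?B x * ?\<kappa> (x - y)) (y, x))))"
      by (intro integrable_mult_right Bochner_Integration.integrable_add \<kappa> integrable_swap_lborel)
    show "(\<lambda>(x, y). \<bar>\<eta> x - \<eta> y\<bar> powr p / norm (x - y) powr (real DIM('a) + s * p))
        \<in> borel_measurable lborel"
      by (simp add: lborel_prod[symmetric])
    show "AE z in lborel. norm (case z of (x, y) \<Rightarrow> \<bar>\<eta> x - \<eta> y\<bar> powr p / norm (x - y) powr (real DIM('a) + s * p))
      \<le> norm (C powr p * ((\<lambda>(x, y). indicator ?B x * ?\<kappa> (x - y)) z
        + (case z of (x, y) \<Rightarrow> (\<lambda>(x, y). indicator ?B x * ?\<kappa> (x - y)) (y, x))))"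
    proof (intro AE_I2, clarify)
      fix x y :: 'a
      have nn: "0 \<le> ?\<kappa> (x - y)" by simp
      have "\<bar>\<eta> x - \<eta> y\<bar> powr p / norm (x - y) powr (real DIM('a) + s * p)
         \<le> C powr p * (indicator ?B x * ?\<kappa> (x - y) + indicator ?B y * ?\<kappa> (x - y))"
      proof (cases "norm x \<le> R \<or> norm y \<le> R")
        case True
        have "\<bar>\<eta> x - \<eta> y\<bar> powr p \<le> (C * min 1 (norm (x - y))) powr p"
          using min sp by (intro powr_mono2) auto
        also have "\<dots> = C powr p * min 1 (norm (x - y)) powr p"
          using C by (simp add: powr_mult)
        finally have "\<bar>\<eta> x - \<eta> y\<bar> powr p / norm (x - y) powr (real DIM('a) + s * p)
           \<le> C powr p * ?\<kappa> (x - y)" by (simp add: divide_right_mono)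
        also have "\<dots> \<le> C powr p * (indicator ?B x * ?\<kappa> (x - y) + indicator ?B y * ?\<kappa> (x - y))"
          using True nn by (intro mult_left_mono) (auto simp: indicator_def)
        finally show ?thesis .
      next
        case False
        then have "\<eta> x = 0" "\<eta> y = 0" using supp by auto
        then show ?thesis using nn by auto
      qed
      moreover have "0 \<le> C powr p * (indicator ?B x * ?\<kappa> (x - y) + indicator ?B y * ?\<kappa> (x - y))"
        using nn by (intro mult_nonneg_nonneg add_nonneg_nonneg) auto
      ultimately show "norm (\<bar>\<eta> x - \<eta> y\<bar> powr p / norm (x - y) powr (real DIM('a) + s * p))
        \<le> norm (C powr p * (indicator ?B x * ?\<kappa> (x - y) + indicator ?B y * ?\<kappa> (y - x)))"
        by (simp add: norm_minus_commute)
    qed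
  qed
qed

text \<open>For a continuous compactly supported approximation this is dominated convergence; the
  general case follows by splitting into three terms, two of which are equal by translation
  invariance.\<close>

lemma L1_translation_continuous:
  fixes f :: "'a::euclidean_space \<Rightarrow> real"
  assumes meas[measurable]: "f \<in> borel_measurable borel"
    and bd: "\<And>x. \<bar>f x\<bar> \<le> M" and supp: "\<And>x. R < norm x \<Longrightarrow> f x = 0"
    and z: "z \<longlonglongrightarrow> 0"
  shows "(\<lambda>m. \<integral>x. \<bar>f (x - z m) - f x\<bar> \<partial>lborel) \<longlonglongrightarrow> 0"
proof -
  have M: "0 \<le> M" using bd[of 0] by linarith
  have "f measurable_on UNIV"
    using measurable_completion[of f lborel borel]
    by (simp add: measurable_on_iff_borel_measurable)
  then obtain N g where N: "negligible N" and g: "\<And>n. continuous_on UNIV (g n)"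
    "\<And>x. x \<notin> N \<Longrightarrow> (\<lambda>n. g n x) \<longlonglongrightarrow> f x" unfolding measurable_on_def by auto
  \<comment> \<open>\<open>measurable_on\<close> supplies continuous functions converging off a
    negligible set. Clipping them to [-M, M] and cutting them off beyond radius \<open>R + 1\<close>
    gives a common majorant and keeps the limit, since \<open>f\<close> is bounded by
    \<open>M\<close> and vanishes beyond \<open>R\<close>.\<close>
  define cut where "cut x = max 0 (min 1 (R + 1 - norm x))" for x :: 'a
  define h where "h n x = max (- M) (min M (g n x)) * cut x" for n x
  have h_cont: "continuous_on UNIV (h n)" for n
    unfolding h_def cut_def by (intro continuous_intros g)
  then have [measurable]: "h n \<in> borel_measurable borel" for n
    by (rule borel_measurable_continuous_onI)
  have h_bd: "\<bar>h n x\<bar> \<le> M * indicator (cball 0 (R + 1)) x" for n x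
  proof -
    have "\<bar>h n x\<bar> \<le> M * cut x" using M by (auto simp: h_def abs_mult cut_def intro!: mult_right_mono)
    also have "\<dots> \<le> M * indicator (cball 0 (R + 1)) x"
      using M by (intro mult_left_mono) (auto simp: cut_def indicator_def)
    finally show ?thesis .
  qed
  have int_ball: "integrable lborel (\<lambda>x. c * indicator (cball (0::'a) r) x :: real)" for c r
    by (intro integrable_mult_right integrable_real_indicator) (auto simp: emeasure_lborel_cball_finite[unfolded infinity_ennreal_def])
  have h_int: "integrable lborel (h n)" for n
    by (rule Bochner_Integration.integrable_bound[OF int_ball[of M "R + 1"]]) (use h_bd M in auto)
  have f_bd: "\<bar>f x\<bar> \<le> M * indicator (cball 0 R) x" for x
    using bd[of x] supp[of x] by (auto simp: indicator_def)
  have f_int: "integrable lborel f"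
    by (rule Bochner_Integration.integrable_bound[OF int_ball[of M R]]) (use f_bd M in auto)
  have h_lim: "(\<lambda>n. h n x) \<longlonglongrightarrow> f x" if "x \<notin> N" for x
  proof -
    have "(\<lambda>n. h n x) \<longlonglongrightarrow> max (- M) (min M (f x)) * cut x"
      unfolding h_def by (intro tendsto_intros g that)
    moreover have "max (- M) (min M (f x)) * cut x = f x"
      using bd[of x] supp[of x] by (auto simp: cut_def max_def min_def)
    ultimately show ?thesis by simp
  qed
  have "AE x in lebesgue. x \<notin> N"
    using N by (intro AE_not_in) (simp add: negligible_iff_null_sets)
  then have ae: "AE x in lborel. (\<lambda>n. \<bar>h n x - f x\<bar>) \<longlonglongrightarrow> 0"
    unfolding AE_completion_iff
    by (rule AE_mp) (auto intro!: AE_I2 tendsto_rabs_zero simp: LIM_zero_iff h_lim)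
  have "(\<lambda>n. \<integral>x. \<bar>h n x - f x\<bar> \<partial>lborel) \<longlonglongrightarrow> (\<integral>x. 0 \<partial>(lborel :: 'a measure))"
  proof (rule integral_dominated_convergence[where w = "\<lambda>x. M * indicator (cball 0 (R + 1)) x + M * indicator (cball 0 R) x"])
    show "AE x in lborel. norm \<bar>h n x - f x\<bar> \<le> M * indicator (cball 0 (R + 1)) x + M * indicator (cball 0 R) x" for n
      by (intro AE_I2, simp, rule order_trans[OF abs_triangle_ineq4 add_mono[OF h_bd f_bd]])
  qed (auto intro!: int_ball ae)
  then have approx: "(\<lambda>n. \<integral>x. \<bar>h n x - f x\<bar> \<partial>lborel) \<longlonglongrightarrow> 0" by simp
  show ?thesis
  proof (rule LIMSEQ_I)
    fix e :: real assume "0 < e"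
    then have "\<forall>\<^sub>F n in sequentially. (\<integral>x. \<bar>h n x - f x\<bar> \<partial>lborel) < e / 3"
      by (intro order_tendstoD(2)[OF approx]) auto
    then obtain n where n: "(\<integral>x. \<bar>h n x - f x\<bar> \<partial>lborel) < e / 3"
      by (auto simp: eventually_sequentially)
    \<comment> \<open>A convergent sequence is bounded, so all translates are supported in one
      common ball.\<close>
    obtain B where B: "\<And>m. norm (z m) \<le> B"
      using convergent_imp_Bseq[OF convergentI[OF z]] by (auto simp: Bseq_def)
    have "0 \<le> B" using B[of 0] norm_ge_zero order_trans by blast
    have "(\<lambda>m. \<integral>x. \<bar>h n (x - z m) - h n x\<bar> \<partial>lborel) \<longlonglongrightarrow> (\<integral>x. 0 \<partial>(lborel :: 'a measure))"
    proof (rule integral_dominated_convergence[where w = "\<lambda>x. 2 * M * indicator (cball 0 (R + 1 + B)) x"])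
      show "integrable lborel (\<lambda>x. 2 * M * indicator (cball (0::'a) (R + 1 + B)) x)" by (rule int_ball)
      show "AE x in lborel. norm \<bar>h n (x - z m) - h n x\<bar> \<le> 2 * M * indicator (cball 0 (R + 1 + B)) x" for m
      proof (intro AE_I2)
        fix x
        have "\<bar>h n (x - z m)\<bar> \<le> M * indicator (cball 0 (R + 1 + B)) x"
        proof (rule order_trans[OF h_bd], rule mult_left_mono)
          have "norm x \<le> norm (x - z m) + norm (z m)" by norm
          then show "indicator (cball 0 (R + 1)) (x - z m) \<le> (indicator (cball 0 (R + 1 + B)) x :: real)"
            using B[of m] by (auto simp: indicator_def)
        qed fact
        moreover have "\<bar>h n x\<bar> \<le> M * indicator (cball 0 (R + 1 + B)) x"
          by (rule order_trans[OF h_bd], rule mult_left_mono) (use \<open>0 \<le> B\<close> M in \<open>auto simp: indicator_def\<close>)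
        ultimately show "norm \<bar>h n (x - z m) - h n x\<bar> \<le> 2 * M * indicator (cball 0 (R + 1 + B)) x"
          using abs_triangle_ineq4[of "h n (x - z m)" "h n x"] by simp
      qed
      have "(\<lambda>m. h n (x - z m)) \<longlonglongrightarrow> h n (x - 0)" for x
        by (rule continuous_on_tendsto_compose[OF h_cont tendsto_diff[OF tendsto_const z]]) auto
      then show "AE x in lborel. (\<lambda>m. \<bar>h n (x - z m) - h n x\<bar>) \<longlonglongrightarrow> 0"
        by (intro AE_I2 tendsto_rabs_zero) (simp add: LIM_zero_iff)
    qed auto
    then have "\<forall>\<^sub>F m in sequentially. (\<integral>x. \<bar>h n (x - z m) - h n x\<bar> \<partial>lborel) < e / 3"
      using \<open>0 < e\<close> by (intro order_tendstoD(2)[where y = 0]) auto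
    then obtain m0 where m0: "\<And>m. m0 \<le> m \<Longrightarrow> (\<integral>x. \<bar>h n (x - z m) - h n x\<bar> \<partial>lborel) < e / 3"
      by (auto simp: eventually_sequentially)
    have "norm ((\<integral>x. \<bar>f (x - z m) - f x\<bar> \<partial>lborel) - 0) < e" if "m0 \<le> m" for m
    proof -
      note sh = integrable_lborel_shift[of _ "z m"]
      have hf: "integrable lborel (\<lambda>x. \<bar>h n x - f x\<bar>)" by (simp add: h_int f_int)
      have "(\<integral>x. \<bar>f (x - z m) - f x\<bar> \<partial>lborel)
         \<le> (\<integral>x. \<bar>h n (x - z m) - f (x - z m)\<bar> + \<bar>h n (x - z m) - h n x\<bar> + \<bar>h n x - f x\<bar> \<partial>lborel)"
        by (rule integral_mono) (auto simp: h_int f_int sh)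
      also have "\<dots> = (\<integral>x. \<bar>h n x - f x\<bar> \<partial>lborel) + (\<integral>x. \<bar>h n (x - z m) - h n x\<bar> \<partial>lborel)
           + (\<integral>x. \<bar>h n x - f x\<bar> \<partial>lborel)"
        using sh(2)[OF hf] by (simp add: h_int f_int sh)
      also have "\<dots> < e" using n m0[OF that] by simp
      finally show ?thesis by simp
    qed
    then show "\<exists>m0. \<forall>m\<ge>m0. norm ((\<integral>x. \<bar>f (x - z m) - f x\<bar> \<partial>lborel) - 0) < e" by blast
  qed
qed

subsection \<open>Mollification and cutoff functions\<close>

lemma borel_measurable_fst_snd [measurable]:
  "fst \<in> borel_measurable (borel :: ('a::euclidean_space \<times> 'a) measure)"
  "snd \<in> borel_measurable (borel :: ('a::euclidean_space \<times> 'a) measure)"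
  by (intro borel_measurable_continuous_onI continuous_on_fst continuous_on_snd continuous_on_id)+

lemma lborel_integral_reflect:
  fixes f :: "'a::euclidean_space \<Rightarrow> real"
  assumes [measurable]: "f \<in> borel_measurable borel"
  shows "(\<integral>x. f (c - x) \<partial>lborel) = (\<integral>x. f x \<partial>lborel)"
proof -
  have eq: "lborel = distr lborel borel (\<lambda>x::'a. c - x)"
    using lborel_affine[of "-1" c] by (simp add: density_1)
  have "(\<integral>x. f x \<partial>lborel) = (\<integral>x. f x \<partial>distr lborel borel (\<lambda>x. c - x))" using eq by simp
  also have "\<dots> = (\<integral>x. f (c - x) \<partial>lborel)" by (subst integral_distr) auto
  finally show ?thesis by simp
qed

text \<open>An exceptional null set \<open>N\<close> in one variable gives two null strips of pairs,
  N x UNIV and UNIV x N.\<close>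

lemma AE_lborel_prod:
  assumes "AE x in lborel. P (x::'a::euclidean_space)"
  shows "AE q in lborel. P (fst q) \<and> P (snd q)"
proof -
  obtain N where N: "{x. \<not> P x} \<subseteq> N" "N \<in> null_sets lborel"
    using AE_E[OF assms] by (auto simp: null_sets_def)
  have "N \<times> UNIV \<in> null_sets (lborel \<Otimes>\<^sub>M lborel)" "UNIV \<times> N \<in> null_sets (lborel \<Otimes>\<^sub>M lborel)"
    using N by auto
  then have "AE q in lborel. q \<notin> N \<times> UNIV" "AE q in lborel. q \<notin> UNIV \<times> N"
    by (auto intro!: AE_not_in simp: lborel_prod)
  then show ?thesis
    by eventually_elim (use N in auto)
qed

lemma integral_pos_ball:
  fixes f :: "'a::euclidean_space \<Rightarrow> real"
  assumes f: "integrable lborel f" "\<And>x. 0 \<le> f x"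
    and pos: "\<And>x. norm x < r \<Longrightarrow> 0 < f x" and "0 < r"
  shows "0 < (\<integral>x. f x \<partial>lborel)"
proof (rule ccontr)
  assume "\<not> ?thesis"
  moreover have "0 \<le> (\<integral>x. f x \<partial>lborel)" using f by simp
  ultimately have "AE x in lborel. f x = 0"
    using integral_nonneg_eq_0_iff_AE[OF f(1) AE_I2[OF f(2)]] by auto
  then have "AE x::'a in lborel. x \<notin> ball 0 r"
    by eventually_elim (use pos in \<open>force simp: not_less\<close>)
  then have "emeasure lborel (ball (0::'a) r) = 0"
    by (subst (asm) AE_iff_measurable[of "ball 0 r"]) auto
  then show False using \<open>0 < r\<close> unit_ball_vol_pos[of "real DIM('a)"] by (simp add: emeasure_ball)
qed

lemma integrable_bounded_compact_support:
  fixes f :: "'a::euclidean_space \<Rightarrow> real"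
  assumes "f \<in> borel_measurable borel" "\<And>x. \<bar>f x\<bar> \<le> M" "\<And>x. x \<notin> S \<Longrightarrow> f x = 0" "compact S"
  shows "integrable lborel f"
proof (rule Bochner_Integration.integrable_bound)
  have [simp]: "S \<in> sets borel" using assms(4) by (intro borel_closed compact_imp_closed)
  show "integrable lborel (\<lambda>x. M * indicator S x :: real)"
    using emeasure_bounded_finite[OF compact_imp_bounded[OF assms(4)]]
    by (intro integrable_mult_right integrable_real_indicator) auto
  have "\<bar>f x\<bar> \<le> M * indicator S x" for x using assms(2,3)[of x] by (auto simp: indicator_def)
  then show "AE x in lborel. norm (f x) \<le> norm (M * indicator S x)"
    by (intro AE_I2) (simp add: order_trans[OF _ abs_ge_self])
qed (use assms in auto)

lemma conv_nonzeroD: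
  assumes "conv f \<rho> x \<noteq> 0"
  shows "\<exists>y. f y \<noteq> 0 \<and> \<rho> (x - y) \<noteq> 0"
proof (rule ccontr)
  assume "\<not> ?thesis"
  then have "(\<lambda>y. f y * \<rho> (x - y)) = (\<lambda>y. 0)" by auto
  with assms show False by (simp add: conv_def)
qed

text \<open>The convolution is supported in the closed \<open>\<delta>\<close>-neighbourhood of
  \<open>S\<close>, which is compact as a Minkowski sum.\<close>

lemma conv_test_function:
  fixes f \<rho> :: "'a::euclidean_space \<Rightarrow> real"
  assumes "f \<in> borel_measurable borel" "\<And>x. \<bar>f x\<bar> \<le> M" "\<And>x. x \<notin> S \<Longrightarrow> f x = 0" "compact S"
    and \<rho>: "\<And>k. C_diff k \<rho>" "\<And>x. \<rho> x \<noteq> 0 \<Longrightarrow> norm x < \<delta>"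
    and sub: "(\<Union>x\<in>S. cball x \<delta>) \<subseteq> \<Omega>"
  shows "conv f \<rho> \<in> test_functions \<Omega>"
proof -
  have "C_diff k (conv f \<rho>)" for k
    using \<rho> by (intro conv_C_diff[where R = \<delta>] integrable_bounded_compact_support[OF assms(1-4)])
      (auto, force)
  moreover have "{x. conv f \<rho> x \<noteq> 0} \<subseteq> (\<Union>x\<in>S. cball x \<delta>)"
  proof
    fix x assume "x \<in> {x. conv f \<rho> x \<noteq> 0}"
    then obtain y where "f y \<noteq> 0" "\<rho> (x - y) \<noteq> 0" using conv_nonzeroD[of f \<rho> x] by auto
    then have "y \<in> S" "dist y x \<le> \<delta>"
      using assms(3) \<rho>(2)[of "x - y"] by (auto simp: dist_norm norm_minus_commute)
    then show "x \<in> (\<Union>x\<in>S. cball x \<delta>)" by auto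
  qed
  then have "closure {x. conv f \<rho> x \<noteq> 0} \<subseteq> (\<Union>x\<in>S. cball x \<delta>)"
    by (rule closure_minimal) (intro compact_imp_closed compact_minkowski_sum_cball assms)
  then have "compactly_contained {x. conv f \<rho> x \<noteq> 0} \<Omega>"
    using compact_minkowski_sum_cball[OF \<open>compact S\<close>, of \<delta>] sub
      compact_Int_closed[of "\<Union>x\<in>S. cball x \<delta>" "closure {x. conv f \<rho> x \<noteq> 0}"]
    by (auto simp: compactly_contained_def Int_absorb1)
  ultimately show ?thesis by (simp add: test_functions_def)
qed

text \<open>\<open>\<psi>\<close> is the indicator of the closed 2r-neighbourhood of
  \<open>S\<close>, mollified at radius \<open>r\<close>: it is constant on the r-neighbourhood and
  zero off the 3r-neighbourhood \<open>D\<close>. The bump is not normalized, so the constant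
  \<open>c\<close> is its integral.\<close>

lemma ex_cutoff:
  fixes S :: "'a::euclidean_space set"
  assumes "compact S" "open \<Omega>" "S \<subseteq> \<Omega>"
  obtains r c D \<psi> where "0 < r" "0 < c" "open D" "compactly_contained D \<Omega>"
    "(\<Union>x\<in>S. cball x r) \<subseteq> \<Omega>" "(\<Union>x\<in>S. ball x r) \<subseteq> D"
    "\<psi> \<in> test_functions \<Omega>" "\<And>x. 0 \<le> \<psi> x" "\<And>x. x \<in> (\<Union>x\<in>S. ball x r) \<Longrightarrow> \<psi> x = c"
    "\<And>x. x \<notin> D \<Longrightarrow> \<psi> x = 0"
proof -
  obtain \<epsilon> where \<epsilon>: "0 < \<epsilon>" "(\<Union>x\<in>S. cball x \<epsilon>) \<subseteq> \<Omega>"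
    using compact_subset_open_imp_cball_epsilon_subset[OF assms] by blast
  define r where "r = \<epsilon> / 3"
  have r: "0 < r" "\<epsilon> = 2 * r + r" using \<epsilon> by (auto simp: r_def)
  define A where "A = (\<Union>x\<in>S. cball x (2 * r))"
  define D where "D = (\<Union>x\<in>S. ball x \<epsilon>)"
  have A: "compact A" unfolding A_def by (intro compact_minkowski_sum_cball assms)
  obtain \<rho> :: "'a \<Rightarrow> real" where \<rho>: "\<And>k. C_diff k \<rho>" "\<And>x. 0 \<le> \<rho> x" "\<And>x. \<rho> x \<noteq> 0 \<longleftrightarrow> norm x < r"
    using ex_bump[OF r(1)] by metis
  have [measurable]: "A \<in> sets borel" using A by (intro borel_closed compact_imp_closed)
  define \<psi> where "\<psi> = conv (indicator A) \<rho>"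
  have \<rho>_cont: "continuous_on UNIV \<rho>" by (rule C_diff_continuous[OF \<rho>(1)])
  then have [measurable]: "\<rho> \<in> borel_measurable borel" by (rule borel_measurable_continuous_onI)
  obtain B where B: "\<And>x. \<bar>\<rho> x\<bar> \<le> B"
    using continuous_compact_support_bounded[OF \<rho>_cont, of r] \<rho>(3) by (metis less_asym)
  have \<rho>_supp: "\<rho> x = 0" if "r < norm x" for x using \<rho>(3)[of x] that by auto
  have \<rho>_int: "integrable lborel \<rho>"
    by (rule integrable_bounded_compact_support[where S = "cball 0 r" and M = B])
       (use B \<rho>_supp in auto)
  show ?thesis
  proof
    show "0 < r" by fact
    show "0 < (\<integral>x. \<rho> x \<partial>lborel)"
      by (rule integral_pos_ball[OF \<rho>_int \<rho>(2) _ r(1)]) (use \<rho>(2,3) in \<open>metis order_less_le\<close>)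
    show "open D" by (auto simp: D_def)
    have "closure D \<subseteq> (\<Union>x\<in>S. cball x \<epsilon>)"
    proof (rule closure_minimal)
      show "D \<subseteq> (\<Union>x\<in>S. cball x \<epsilon>)" unfolding D_def by (intro UN_mono ball_subset_cball) auto
      show "closed (\<Union>x\<in>S. cball x \<epsilon>)" by (intro compact_imp_closed compact_minkowski_sum_cball assms)
    qed
    then show "compactly_contained D \<Omega>"
      using compact_minkowski_sum_cball[OF assms(1), of \<epsilon>] \<epsilon>(2)
        compact_Int_closed[of "\<Union>x\<in>S. cball x \<epsilon>" "closure D"]
      by (auto simp: compactly_contained_def Int_absorb1)
    have "(\<Union>x\<in>S. cball x r) \<subseteq> (\<Union>x\<in>S. cball x \<epsilon>)"
      using r by (intro UN_mono subset_cball) auto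
    with \<epsilon>(2) show "(\<Union>x\<in>S. cball x r) \<subseteq> \<Omega>" by (rule subset_trans[rotated])
    show "(\<Union>x\<in>S. ball x r) \<subseteq> D" unfolding D_def using r by (intro UN_mono subset_ball) auto
    have sub: "(\<Union>x\<in>A. cball x r) \<subseteq> (\<Union>x\<in>S. cball x \<epsilon>)"
    proof
      fix y assume "y \<in> (\<Union>x\<in>A. cball x r)"
      then obtain a x where "x \<in> S" "dist x a \<le> 2 * r" "dist a y \<le> r" by (auto simp: A_def)
      then show "y \<in> (\<Union>x\<in>S. cball x \<epsilon>)"
        using dist_triangle[of x y a] r(2) by (intro UN_I[of x]) auto
    qed
    show "\<psi> \<in> test_functions \<Omega>" unfolding \<psi>_def
      by (rule conv_test_function[where M = 1 and S = A and \<delta> = r])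
         (use A \<rho> sub \<epsilon>(2) in \<open>auto simp: indicator_def\<close>)
    show "0 \<le> \<psi> x" for x
      unfolding \<psi>_def conv_def by (intro Bochner_Integration.integral_nonneg mult_nonneg_nonneg \<rho>) auto
    show "\<psi> x = 0" if "x \<notin> D" for x
    proof (rule ccontr)
      assume "\<psi> x \<noteq> 0"
      then obtain y where "y \<in> A" "\<rho> (x - y) \<noteq> 0"
        using conv_nonzeroD[of "indicator A" \<rho> x] by (auto simp: \<psi>_def indicator_def split: if_splits)
      then obtain a where "a \<in> S" "dist a y \<le> 2 * r" "dist y x < r"
        using \<rho>(3)[of "x - y"] by (auto simp: A_def dist_norm norm_minus_commute)
      then have "x \<in> D" unfolding D_def
        using dist_triangle[of a x y] r(2) by (intro UN_I[of a]) auto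
      with that show False ..
    qed
    show "\<psi> x = (\<integral>x. \<rho> x \<partial>lborel)" if x: "x \<in> (\<Union>x\<in>S. ball x r)" for x
    proof -
      obtain a where a: "a \<in> S" "dist a x < r" using x by auto
      have "indicator A y * \<rho> (x - y) = \<rho> (x - y)" for y
      proof (cases "\<rho> (x - y) = 0")
        case False
        then have "dist x y < r" using \<rho>(3)[of "x - y"] by (simp add: dist_norm)
        then have "y \<in> A" unfolding A_def
          using dist_triangle[of a y x] a by (intro UN_I[of a]) auto
        then show ?thesis by simp
      qed simp
      then have "\<psi> x = (\<integral>y. \<rho> (x - y) \<partial>lborel)" by (simp only: \<psi>_def conv_def)
      then show ?thesis by (simp add: lborel_integral_reflect)
    qed
  qed
qed

text \<open>A crude form of Young's inequality: replacing both factors by powers of the larger of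
  \<open>a\<close> and \<open>b\<close> already gives one of the two summands.\<close>

lemma powr_mult_le_add:
  fixes a b p :: real
  assumes "0 \<le> a" "0 \<le> b" "1 < p"
  shows "a powr (p - 1) * b \<le> a powr p + b powr p"
proof (cases "a \<le> b")
  case True
  then have "a powr (p - 1) * b \<le> b * b powr (p - 1)"
    using assms by (subst mult.commute, intro mult_left_mono powr_mono2) auto
  also have "\<dots> = b powr p" using assms by (simp add: powr_mult_base)
  finally show ?thesis by (simp add: add_increasing)
next
  case False
  then have "a powr (p - 1) * b \<le> a * a powr (p - 1)"
    using assms by (subst mult.commute, intro mult_right_mono) auto
  also have "\<dots> = a powr p" using assms by (simp add: powr_mult_base)
  finally show ?thesis by (simp add: add_increasing2)
qed

text \<open>This is Fatou's lemma, applied in \<open>ennreal\<close>. Nonnegativity passes to the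
  limit and forces \<open>C\<close> to be nonnegative, so the estimate can be read back for Bochner
  integrals.\<close>

lemma integral_le_liminf_bound:
  fixes H :: "nat \<Rightarrow> 'a \<Rightarrow> real"
  assumes int: "\<And>m. integrable M (H m)" "integrable M H'" and nn: "\<And>m. AE x in M. 0 \<le> H m x"
    and lim: "AE x in M. (\<lambda>m. H m x) \<longlonglongrightarrow> H' x"
    and le: "\<And>m. (\<integral>x. H m x \<partial>M) \<le> C"
  shows "(\<integral>x. H' x \<partial>M) \<le> C"
proof -
  have "AE x in M. \<forall>m. 0 \<le> H m x" using nn by (simp add: AE_all_countable)
  then have nn': "AE x in M. 0 \<le> H' x"
    using lim by eventually_elim (auto intro: LIMSEQ_le_const)
  have "0 \<le> (\<integral>x. H 0 x \<partial>M)" by (rule integral_nonneg_AE[OF nn])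
  then have C: "0 \<le> C" using le[of 0] by linarith
  have "(\<integral>\<^sup>+x. ennreal (H' x) \<partial>M) = (\<integral>\<^sup>+x. liminf (\<lambda>m. ennreal (H m x)) \<partial>M)"
    using lim by (intro nn_integral_cong_AE, eventually_elim)
      (auto intro!: lim_imp_Liminf[symmetric] tendsto_ennrealI)
  also have "\<dots> \<le> liminf (\<lambda>m. \<integral>\<^sup>+x. ennreal (H m x) \<partial>M)"
    using int by (intro nn_integral_liminf) auto
  also have "\<dots> \<le> ennreal C"
    using nn int le by (intro Liminf_le) (auto intro!: always_eventually ennreal_leI simp: nn_integral_eq_integral)
  finally have "ennreal (\<integral>x. H' x \<partial>M) \<le> ennreal C"
    using int nn' by (simp add: nn_integral_eq_integral)
  then show ?thesis using C by simp
qed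

subsection \<open>Nonnegativity on Sobolev test functions\<close>

text \<open>\<open>G\<close> stands for \<open>|u x - u y|\<^sup>p\<^sup>-\<^sup>2 (u x - u y) K x y\<close> and \<open>w\<close> for \<open>|z|\<^sup>-\<^sup>n\<^sup>-\<^sup>s\<^sup>p\<close>, both Borel measurable, so
  that Fubini applies on \<open>lborel\<close> without regard to null sets.\<close>

locale nonneg_form =
  fixes G :: "'a::euclidean_space \<times> 'a \<Rightarrow> real" and u w :: "'a \<Rightarrow> real"
    and p \<Lambda> :: real and \<Omega> :: "'a set"
  assumes G_meas [measurable]: "G \<in> borel_measurable borel"
    and u_meas [measurable]: "u \<in> borel_measurable borel"
    and w_meas [measurable]: "w \<in> borel_measurable borel"
    and w_nonneg: "\<And>z. 0 \<le> w z"
    and p: "1 < p" and Lambda: "0 \<le> \<Lambda>" and \<Omega>: "open \<Omega>"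
    and G_bound: "\<And>x y. \<bar>G (x, y)\<bar> \<le> \<Lambda> * (\<bar>u x - u y\<bar> powr (p - 1) * w (x - y))"
    and G_test: "\<And>\<eta>. \<eta> \<in> test_functions \<Omega> \<Longrightarrow> (\<And>x. 0 \<le> \<eta> x) \<Longrightarrow>
      integrable lborel (\<lambda>q. G q * (\<eta> (fst q) - \<eta> (snd q))) \<and>
      0 \<le> (\<integral>q. G q * (\<eta> (fst q) - \<eta> (snd q)) \<partial>lborel)"
    and u_local: "\<And>D. open D \<Longrightarrow> compactly_contained D \<Omega> \<Longrightarrow>
      integrable lborel (\<lambda>q. indicator (D \<times> D) q * (\<bar>u (fst q) - u (snd q)\<bar> powr p * w (fst q - snd q)))"
begin

text \<open>The test function of interest involves \<open>u\<close> and so is only Borel measurable;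
  boundedness, compact support in \<open>\<Omega>\<close> and a finite Gagliardo integral are what
  it retains.\<close>

lemma nonneg_on_Sobolev_test:
  fixes \<phi> :: "'a \<Rightarrow> real"
  assumes \<phi>_meas [measurable]: "\<phi> \<in> borel_measurable borel"
    and \<phi>: "\<And>x. 0 \<le> \<phi> x" "\<And>x. \<phi> x \<le> M" "\<And>x. x \<notin> S \<Longrightarrow> \<phi> x = 0"
    and S: "compact S" "S \<subseteq> \<Omega>"
    and \<phi>_int: "integrable lborel (\<lambda>q. \<bar>\<phi> (fst q) - \<phi> (snd q)\<bar> powr p * w (fst q - snd q))"
  shows "integrable lborel (\<lambda>q. G q * (\<phi> (fst q) - \<phi> (snd q)))"
    and "0 \<le> (\<integral>q. G q * (\<phi> (fst q) - \<phi> (snd q)) \<partial>lborel)"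
proof -
  obtain r c D \<psi> where r: "0 < r" and c: "0 < c" and D: "open D" "compactly_contained D \<Omega>"
    and sub\<Omega>: "(\<Union>x\<in>S. cball x r) \<subseteq> \<Omega>" and subD: "(\<Union>x\<in>S. ball x r) \<subseteq> D"
    and \<psi>: "\<psi> \<in> test_functions \<Omega>" "\<And>x. 0 \<le> \<psi> x" "\<And>x. x \<in> (\<Union>x\<in>S. ball x r) \<Longrightarrow> \<psi> x = c"
    "\<And>x. x \<notin> D \<Longrightarrow> \<psi> x = 0"
    using ex_cutoff[OF S(1) \<Omega> S(2)] by metis
  have M: "0 \<le> M" using \<phi>(1,2)[of 0] by linarith
  have \<phi>_bd: "\<bar>\<phi> x - \<phi> y\<bar> \<le> M" for x y
    using \<phi>(1,2)[of x] \<phi>(1,2)[of y] by linarith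
  \<comment> \<open>\<open>d z\<close> is the increment of the translate of \<open>\<phi>\<close> by
    \<open>z\<close>. Since \<open>w\<close> sees only x - y, the Gagliardo density of the translate
    is \<open>E\<close> shifted along the diagonal, which keeps its integral.\<close>
  define d where "d z q = \<phi> (fst q - z) - \<phi> (snd q - z)" for z and q :: "'a \<times> 'a"
  define E where "E q = \<bar>\<phi> (fst q) - \<phi> (snd q)\<bar> powr p * w (fst q - snd q)" for q
  \<comment> \<open>The first summand serves pairs inside \<open>D\<close>. The second serves pairs
    with a point outside, where \<open>M / c\<close> converts the jump \<open>c\<close> of
    \<open>\<psi>\<close> into the bound \<open>M\<close> for the increment of
    \<open>\<phi>\<close>.\<close>
  define F where "F q = \<Lambda> * (indicator (D \<times> D) q * (\<bar>u (fst q) - u (snd q)\<bar> powr p * w (fst q - snd q)))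
      + M / c * \<bar>G q * (\<psi> (fst q) - \<psi> (snd q))\<bar>" for q
  have d_meas [measurable]: "d z \<in> borel_measurable borel" for z unfolding d_def by measurable
  have E_shift: "E (q - (z, z)) = \<bar>d z q\<bar> powr p * w (fst q - snd q)" for q z
    by (simp add: E_def d_def)
  have E_int: "integrable lborel E" using \<phi>_int by (simp add: E_def[abs_def])
  have F_int: "integrable lborel F" unfolding F_def[abs_def]
    using u_local[OF D] G_test[OF \<psi>(1,2)] by auto
  define C where "C = (\<integral>q. F q \<partial>lborel) + \<Lambda> * (\<integral>q. E q \<partial>lborel)"
  have FE_int: "integrable lborel (\<lambda>q. F q + \<Lambda> * E (q - (z, z)))"
    and FE: "(\<integral>q. F q + \<Lambda> * E (q - (z, z)) \<partial>lborel) = C" for z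
    using F_int integrable_lborel_shift[OF E_int, of "(z, z)"] by (simp_all add: C_def)
  txt \<open>Young's inequality on \<open>D \<times> D\<close>; elsewhere \<open>\<psi>\<close> jumps by \<open>c\<close> wherever the translate of \<open>\<phi>\<close> does not vanish.\<close>
  have G_d: "\<bar>G q * d z q\<bar> \<le> F q + \<Lambda> * E (q - (z, z))" if z: "norm z < r" for q z
  proof (cases q)
    case (Pair x y)
    have E0: "0 \<le> \<Lambda> * E (q - (z, z))" using Lambda w_nonneg by (simp add: E_def)
    have F0: "0 \<le> \<Lambda> * (indicator (D \<times> D) q * (\<bar>u (fst q) - u (snd q)\<bar> powr p * w (fst q - snd q)))"
      using Lambda w_nonneg by simp
    have F1: "0 \<le> M / c * \<bar>G q * (\<psi> (fst q) - \<psi> (snd q))\<bar>" using M c by simp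
    have inS: "x \<in> (\<Union>x\<in>S. ball x r)" if "\<phi> (x - z) \<noteq> 0" for x
    proof -
      from that have "x - z \<in> S" using \<phi>(3) by blast
      then show ?thesis using z by (intro UN_I[of "x - z"]) (auto simp: dist_norm)
    qed
    consider "x \<in> D \<and> y \<in> D" | "\<not> (x \<in> D \<and> y \<in> D)" "\<phi> (x - z) \<noteq> 0"
      | "\<not> (x \<in> D \<and> y \<in> D)" "\<phi> (y - z) \<noteq> 0" | "\<phi> (x - z) = 0" "\<phi> (y - z) = 0" by blast
    then show ?thesis
    proof cases
      case 1
      have "\<bar>G q * d z q\<bar> \<le> \<Lambda> * (\<bar>u x - u y\<bar> powr (p - 1) * w (x - y)) * \<bar>d z q\<bar>"
        unfolding abs_mult by (intro mult_right_mono) (use G_bound Pair in auto)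
      also have "\<dots> = \<Lambda> * w (x - y) * (\<bar>u x - u y\<bar> powr (p - 1) * \<bar>d z q\<bar>)" by simp
      also have "\<dots> \<le> \<Lambda> * w (x - y) * (\<bar>u x - u y\<bar> powr p + \<bar>d z q\<bar> powr p)"
        using Lambda w_nonneg p by (intro mult_left_mono powr_mult_le_add) auto
      also have "\<dots> = \<Lambda> * (indicator (D \<times> D) q * (\<bar>u (fst q) - u (snd q)\<bar> powr p * w (fst q - snd q)))
          + \<Lambda> * E (q - (z, z))"
        unfolding E_shift using Pair 1 by (simp add: algebra_simps)
      finally show ?thesis using F1 by (simp add: F_def)
    next
      case 2
      then have x: "x \<in> (\<Union>x\<in>S. ball x r)" "y \<notin> D" using inS subD by blast+
      have "\<bar>G q * d z q\<bar> \<le> \<bar>G q\<bar> * M"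
        unfolding abs_mult d_def by (intro mult_left_mono \<phi>_bd) auto
      also have "\<dots> = M / c * \<bar>G q * (\<psi> (fst q) - \<psi> (snd q))\<bar>"
        using \<psi>(3)[OF x(1)] \<psi>(4)[OF x(2)] c Pair by (simp add: abs_mult)
      finally show ?thesis using F0 E0 by (simp add: F_def)
    next
      case 3
      then have x: "y \<in> (\<Union>x\<in>S. ball x r)" "x \<notin> D" using inS subD by blast+
      have "\<bar>G q * d z q\<bar> \<le> \<bar>G q\<bar> * M"
        unfolding abs_mult d_def by (intro mult_left_mono \<phi>_bd) auto
      also have "\<dots> = M / c * \<bar>G q * (\<psi> (fst q) - \<psi> (snd q))\<bar>"
        using \<psi>(3)[OF x(1)] \<psi>(4)[OF x(2)] c Pair by (simp add: abs_mult)
      finally show ?thesis using F0 E0 by (simp add: F_def)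
    next
      case 4
      then show ?thesis using E0 F0 F1 Pair by (simp add: F_def d_def)
    qed
  qed
  have Gd_int: "integrable lborel (\<lambda>q. G q * d z q)" if "norm z < r" for z
    by (rule Bochner_Integration.integrable_bound[OF FE_int[of z]])
       (auto intro!: AE_I2 order_trans[OF G_d[OF that] abs_ge_self])
  define T where "T z = (\<integral>q. G q * d z q \<partial>lborel)" for z

  \<comment> \<open>If \<open>T\<close> were negative on a whole ball, its average against a bump
    would be strictly negative; by Fubini this average is the form at a smooth nonnegative test
    function.\<close>
  have ex_nonneg: "\<exists>z. norm z < \<delta> \<and> 0 \<le> T z" if \<delta>: "0 < \<delta>" "\<delta> \<le> r" for \<delta>
  proof (rule ccontr)
    assume "\<not> ?thesis"
    then have neg: "T z < 0" if "norm z < \<delta>" for z using that by (auto simp: not_le)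
    obtain \<rho> :: "'a \<Rightarrow> real" where \<rho>: "\<And>k. C_diff k \<rho>" "\<And>x. 0 \<le> \<rho> x" "\<And>x. \<rho> x \<noteq> 0 \<longleftrightarrow> norm x < \<delta>"
      using ex_bump[OF \<delta>(1)] by metis
    have \<rho>_supp: "\<rho> x = 0" if "\<delta> < norm x" for x using \<rho>(3)[of x] that by auto
    have \<rho>_cont: "continuous_on UNIV \<rho>" by (rule C_diff_continuous[OF \<rho>(1)])
    then have \<rho>_meas [measurable]: "\<rho> \<in> borel_measurable borel" by (rule borel_measurable_continuous_onI)
    obtain B where B: "\<And>x. \<bar>\<rho> x\<bar> \<le> B"
      using continuous_compact_support_bounded[OF \<rho>_cont \<rho>_supp] by blast
    have \<rho>_int: "integrable lborel \<rho>"
      by (rule integrable_bounded_compact_support[where S = "cball 0 \<delta>" and M = B])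
         (use B \<rho>_supp in auto)
    have \<phi>_int': "integrable lborel \<phi>"
      by (rule integrable_bounded_compact_support[where S = S and M = M]) (use \<phi> S in auto)
    let ?f = "\<lambda>z q. \<rho> z * (G q * d z q)"
    have conv_eq: "conv \<phi> \<rho> x = (\<integral>z. \<rho> z * \<phi> (x - z) \<partial>lborel)" for x
      unfolding conv_def using lborel_integral_reflect[of "\<lambda>z. \<rho> z * \<phi> (x - z)" x]
      by (simp add: mult.commute)
    have conv_int: "integrable lborel (\<lambda>z. \<rho> z * \<phi> (x - z))" for x
      by (intro integrable_mult_bounded[where B = M] \<rho>_int) (use \<phi> in auto)
    have conv_test: "conv \<phi> \<rho> \<in> test_functions \<Omega>"
    proof (rule conv_test_function[where M = M and S = S and \<delta> = \<delta>])
      have "(\<Union>x\<in>S. cball x \<delta>) \<subseteq> (\<Union>x\<in>S. cball x r)"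
        using \<delta> by (intro UN_mono subset_cball) auto
      with sub\<Omega> show "(\<Union>x\<in>S. cball x \<delta>) \<subseteq> \<Omega>" by (rule subset_trans[rotated])
    qed (use \<phi> S \<rho> in auto)
    have conv_nonneg: "0 \<le> conv \<phi> \<rho> x" for x
      unfolding conv_eq by (intro Bochner_Integration.integral_nonneg mult_nonneg_nonneg \<rho> \<phi>)
    have f_meas: "case_prod ?f \<in> borel_measurable (lborel \<Otimes>\<^sub>M lborel)"
      unfolding d_def by measurable
    \<comment> \<open>Fubini applies because the inner integral over pairs is at most
      \<open>\<rho> z\<close> times \<open>C\<close>, with the same \<open>C\<close> for every
      \<open>z\<close>.\<close>
    have f_int: "integrable (lborel \<Otimes>\<^sub>M lborel) (case_prod ?f)"
    proof (rule integrableI_bounded[OF f_meas])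
      have "(\<integral>\<^sup>+x. ennreal (norm (case_prod ?f x)) \<partial>(lborel \<Otimes>\<^sub>M lborel))
        = (\<integral>\<^sup>+z. \<integral>\<^sup>+q. ennreal (norm (?f z q)) \<partial>lborel \<partial>lborel)"
        using f_meas by (subst lborel.nn_integral_fst[symmetric]) auto
      also have "\<dots> \<le> (\<integral>\<^sup>+z. ennreal (\<rho> z) * ennreal C \<partial>lborel)"
      proof (rule nn_integral_mono)
        fix z :: 'a
        show "(\<integral>\<^sup>+q. ennreal (norm (?f z q)) \<partial>lborel) \<le> ennreal (\<rho> z) * ennreal C"
        proof (cases "norm z < \<delta>")
          case True
          then have zr: "norm z < r" using \<delta> by simp
          have "(\<integral>\<^sup>+q. ennreal (norm (?f z q)) \<partial>lborel)
              \<le> (\<integral>\<^sup>+q. ennreal (\<rho> z) * ennreal (F q + \<Lambda> * E (q - (z, z))) \<partial>lborel)"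
          proof (rule nn_integral_mono)
            fix q
            have "norm (?f z q) \<le> \<rho> z * (F q + \<Lambda> * E (q - (z, z)))"
              using mult_left_mono[OF G_d[OF zr, of q] \<rho>(2)[of z]] \<rho>(2)[of z] by (simp add: abs_mult)
            then show "ennreal (norm (?f z q)) \<le> ennreal (\<rho> z) * ennreal (F q + \<Lambda> * E (q - (z, z)))"
              using \<rho>(2) by (simp add: ennreal_mult'[symmetric] ennreal_leI)
          qed
          also have "\<dots> = ennreal (\<rho> z) * (\<integral>\<^sup>+q. ennreal (F q + \<Lambda> * E (q - (z, z))) \<partial>lborel)"
            using borel_measurable_integrable[OF FE_int[of z]] by (intro nn_integral_cmult) simp
          also have "(\<integral>\<^sup>+q. ennreal (F q + \<Lambda> * E (q - (z, z))) \<partial>lborel) = ennreal C"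
            using order_trans[OF abs_ge_zero G_d[OF zr]]
            by (subst nn_integral_eq_integral[OF FE_int]) (auto simp: FE)
          finally show ?thesis .
        next
          case False
          then have "\<rho> z = 0" using \<rho>(3) by blast
          then show ?thesis by simp
        qed
      qed
      also have "\<dots> = (\<integral>\<^sup>+z. ennreal (\<rho> z) \<partial>lborel) * ennreal C"
        by (intro nn_integral_multc) auto
      also have "\<dots> < \<infinity>"
        using \<rho>_int \<rho>(2) by (simp add: nn_integral_eq_integral ennreal_mult_less_top)
      finally show "(\<integral>\<^sup>+x. ennreal (norm (case_prod ?f x)) \<partial>(lborel \<Otimes>\<^sub>M lborel)) < \<infinity>" .
    qed
    have "(\<integral>q. G q * (conv \<phi> \<rho> (fst q) - conv \<phi> \<rho> (snd q)) \<partial>lborel)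
        = (\<integral>q. (\<integral>z. ?f z q \<partial>lborel) \<partial>lborel)"
    proof (rule Bochner_Integration.integral_cong[OF refl])
      fix q
      have "(\<integral>z. ?f z q \<partial>lborel) = (\<integral>z. G q * (\<rho> z * \<phi> (fst q - z) - \<rho> z * \<phi> (snd q - z)) \<partial>lborel)"
        by (intro Bochner_Integration.integral_cong refl) (simp add: d_def algebra_simps)
      also have "\<dots> = G q * (conv \<phi> \<rho> (fst q) - conv \<phi> \<rho> (snd q))"
        by (simp add: conv_eq conv_int)
      finally show "G q * (conv \<phi> \<rho> (fst q) - conv \<phi> \<rho> (snd q)) = (\<integral>z. ?f z q \<partial>lborel)" ..
    qed
    also have "\<dots> = (\<integral>z. (\<integral>q. ?f z q \<partial>lborel) \<partial>lborel)"
      by (rule lborel_pair.Fubini_integral[OF f_int])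
    also have "\<dots> = (\<integral>z. \<rho> z * T z \<partial>lborel)" by (simp add: T_def)
    finally have "0 \<le> (\<integral>z. \<rho> z * T z \<partial>lborel)"
      using G_test[OF conv_test conv_nonneg] by simp
    moreover have "integrable lborel (\<lambda>z. \<rho> z * T z)"
      using lborel_pair.integrable_fst[OF f_int] by (simp add: T_def)
    then have "0 < (\<integral>z. - (\<rho> z * T z) \<partial>lborel)"
    proof (intro integral_pos_ball[where r = \<delta>])
      show "0 \<le> - (\<rho> z * T z)" for z
        using \<rho>(2)[of z] \<rho>(3)[of z] neg[of z]
        by (cases "norm z < \<delta>") (auto simp: mult_le_0_iff)
      show "0 < - (\<rho> z * T z)" if "norm z < \<delta>" for z
        using \<rho>(2)[of z] \<rho>(3)[of z] neg[of z] that by (auto simp: mult_less_0_iff)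
    qed (use \<delta> in auto)
    ultimately show False by simp
  qed

  have "\<exists>z. norm z < r / real (Suc m) \<and> 0 \<le> T z" for m
    using r by (intro ex_nonneg) (auto simp: divide_le_eq)
  then obtain z where z: "\<And>m. norm (z m) < r / real (Suc m)" "\<And>m. 0 \<le> T (z m)" by metis
  have "(\<lambda>m. r / real (Suc m)) \<longlonglongrightarrow> 0"
    using LIMSEQ_Suc[OF lim_const_over_n[of r]] by simp
  then have z_lim: "z \<longlonglongrightarrow> 0"
    by (rule Lim_null_comparison[rotated]) (use z(1) in \<open>auto intro!: always_eventually less_imp_le\<close>)
  obtain R where R: "\<And>x. x \<in> S \<Longrightarrow> norm x \<le> R"
    using compact_imp_bounded[OF S(1)] by (auto simp: bounded_iff)
  have \<phi>_int': "integrable lborel \<phi>"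
    by (rule integrable_bounded_compact_support[where S = S and M = M]) (use \<phi> S in auto)
  have "(\<lambda>m. \<integral>x. norm (\<phi> (x - z m) - \<phi> x) \<partial>lborel) \<longlonglongrightarrow> 0"
    unfolding real_norm_def
    by (rule L1_translation_continuous[where M = M and R = R, OF _ _ _ z_lim])
       (use \<phi> R in \<open>auto simp: not_le[symmetric]\<close>)
  \<comment> \<open>The translates converge in L^1, so along a subsequence they converge almost
    everywhere, as Fatou's lemma requires.\<close>
  then obtain k where k: "strict_mono k" "AE x in lborel. (\<lambda>m. \<phi> (x - z (k m)) - \<phi> x) \<longlonglongrightarrow> 0"
    using tendsto_L1_AE_subseq[of lborel "\<lambda>m x. \<phi> (x - z m) - \<phi> x"]
      integrable_lborel_shift(1)[OF \<phi>_int'] \<phi>_int' by auto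
  \<comment> \<open>\<open>H m\<close> is the majorant minus the integrand, hence nonnegative. The
    majorant varies with \<open>m\<close>, but its integral is always \<open>C\<close>, so
    \<open>H m\<close> has integral \<open>C - T (z (k m))\<close>, at most \<open>C\<close>.
    Fatou's lemma then gives \<open>C - T 0\<close> at most \<open>C\<close>.\<close>
  define H where "H m q = F q + \<Lambda> * E (q - (z (k m), z (k m))) - G q * d (z (k m)) q" for m q
  define H' where "H' q = F q + \<Lambda> * E (q - (0, 0)) - G q * d 0 q" for q
  have zr: "norm (z m) < r" for m
    using less_le_trans[OF z(1)[of m], of r] r by (simp add: divide_le_eq)
  have "(\<integral>q. H' q \<partial>lborel) \<le> C"
  proof (rule integral_le_liminf_bound[of _ H])
    show "integrable lborel (H m)" for m
      unfolding H_def[abs_def] by (intro Bochner_Integration.integrable_diff FE_int Gd_int zr)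
    show "integrable lborel H'"
      unfolding H'_def[abs_def] using r by (intro Bochner_Integration.integrable_diff FE_int Gd_int) auto
    show "AE q in lborel. 0 \<le> H m q" for m
      using G_d[OF zr[of "k m"]] by (intro AE_I2) (auto simp: H_def abs_le_iff)
    have "(\<integral>q. H m q \<partial>lborel) = C - T (z (k m))" for m
      unfolding H_def[abs_def] T_def FE[symmetric, of "z (k m)"]
      by (intro Bochner_Integration.integral_diff FE_int Gd_int zr)
    then show "(\<integral>q. H m q \<partial>lborel) \<le> C" for m using z(2) by simp
    have d_lim: "(\<lambda>m. H m q) \<longlonglongrightarrow> H' q"
      if 1: "(\<lambda>m. \<phi> (fst q - z (k m)) - \<phi> (fst q)) \<longlonglongrightarrow> 0"
        "(\<lambda>m. \<phi> (snd q - z (k m)) - \<phi> (snd q)) \<longlonglongrightarrow> 0" for q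
    proof -
      have "(\<lambda>m. d (z (k m)) q) \<longlonglongrightarrow> d 0 q"
        unfolding d_def using 1 by (intro tendsto_diff) (simp_all add: LIM_zero_iff)
      then show ?thesis
        unfolding H_def H'_def E_shift using p
        by (intro tendsto_intros tendsto_powr') auto
    qed
    show "AE q in lborel. (\<lambda>m. H m q) \<longlonglongrightarrow> H' q"
      using AE_lborel_prod[OF k(2)] by eventually_elim (auto intro: d_lim)
  qed
  moreover have "(\<integral>q. H' q \<partial>lborel) = C - T 0"
    unfolding H'_def[abs_def] T_def FE[symmetric, of 0]
    using r by (intro Bochner_Integration.integral_diff FE_int Gd_int) auto
  ultimately have "0 \<le> T 0" by simp
  then show "0 \<le> (\<integral>q. G q * (\<phi> (fst q) - \<phi> (snd q)) \<partial>lborel)" by (simp add: T_def d_def)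
  show "integrable lborel (\<lambda>q. G q * (\<phi> (fst q) - \<phi> (snd q)))"
    using Gd_int[of 0] r by (simp add: d_def)
qed

end

subsection \<open>Truncation\<close>

text \<open>The nonlinearity of the p-Laplacian, written \<open>J\<close> in the overview.\<close>

definition flux :: "real \<Rightarrow> real \<Rightarrow> real" where
  "flux p t = \<bar>t\<bar> powr (p - 2) * t"

text \<open>At \<open>t = 0\<close> both sides vanish because \<open>0 powr a = 0\<close> for every
  exponent, so p < 2 is no exception.\<close>

lemma abs_flux: "\<bar>flux p t\<bar> = \<bar>t\<bar> powr (p - 1)"
proof (cases "t = 0")
  case False
  have "\<bar>t\<bar> * \<bar>t\<bar> powr (p - 2) = \<bar>t\<bar> powr (1 + (p - 2))" by (rule powr_mult_base) simp
  then show ?thesis by (simp add: flux_def abs_mult mult.commute)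
qed (simp add: flux_def)

lemma flux_minus: "flux p (- t) = - flux p t"
  by (simp add: flux_def)

lemma flux_nonneg: "0 \<le> t \<Longrightarrow> 0 \<le> flux p t"
  by (simp add: flux_def)

lemma abs_flux_mono: "\<bar>s\<bar> \<le> \<bar>t\<bar> \<Longrightarrow> 1 \<le> p \<Longrightarrow> \<bar>flux p s\<bar> \<le> \<bar>flux p t\<bar>"
  unfolding abs_flux by (intro powr_mono2) auto

lemma abs_min_diff_le: "\<bar>min a k - min b k\<bar> \<le> \<bar>a - b :: real\<bar>"
  by (auto simp: min_def)

lemma powr_add_le:
  fixes a b :: real
  assumes "0 \<le> a" "0 \<le> b" "0 \<le> p"
  shows "(a + b) powr p \<le> 2 powr p * (a powr p + b powr p)"
proof -
  have "(a + b) powr p \<le> (2 * max a b) powr p" using assms by (intro powr_mono2) auto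
  also have "\<dots> = 2 powr p * max a b powr p" using assms by (simp add: powr_mult)
  also have "\<dots> \<le> 2 powr p * (a powr p + b powr p)"
    by (intro mult_left_mono) (auto simp: max_def)
  finally show ?thesis .
qed

text \<open>This is \<open>h\<^sub>e\<close> of the overview. Its slope is bounded by 1/e, which
  keeps the ramped test function in the Sobolev class for each fixed \<open>e\<close>.\<close>

definition ramp :: "real \<Rightarrow> real \<Rightarrow> real \<Rightarrow> real" where
  "ramp k e t = max 0 (min 1 (1 - (t - k) / e))"

lemma ramp_bounds: "0 \<le> ramp k e t" "ramp k e t \<le> 1"
  by (auto simp: ramp_def)

lemma ramp_eq_1: "t \<le> k \<Longrightarrow> 0 < e \<Longrightarrow> ramp k e t = 1"
  by (auto simp: ramp_def divide_nonpos_pos)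

lemma ramp_eq_0: "k + e \<le> t \<Longrightarrow> 0 < e \<Longrightarrow> ramp k e t = 0"
  by (simp add: ramp_def max_def min_def field_simps)

lemma ramp_antimono: "s \<le> t \<Longrightarrow> 0 < e \<Longrightarrow> ramp k e t \<le> ramp k e s"
  unfolding ramp_def by (intro max.mono min.mono diff_mono divide_right_mono) auto

lemma ramp_lipschitz:
  assumes "0 < e"
  shows "\<bar>ramp k e s - ramp k e t\<bar> \<le> \<bar>s - t\<bar> / e"
proof -
  have clip: "\<bar>max 0 (min 1 x) - max 0 (min 1 y)\<bar> \<le> \<bar>x - y\<bar>" for x y :: real by linarith
  have "\<bar>ramp k e s - ramp k e t\<bar> \<le> \<bar>(1 - (s - k) / e) - (1 - (t - k) / e)\<bar>"
    unfolding ramp_def by (rule clip)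
  also have "(1 - (s - k) / e) - (1 - (t - k) / e) = (t - s) / e"
    by (simp add: diff_divide_distrib)
  finally show ?thesis using assms by (simp add: abs_minus_commute)
qed

lemma ramp_measurable [measurable]: "ramp k e \<in> borel_measurable borel"
  unfolding ramp_def[abs_def] by measurable

lemma flux_measurable [measurable]: "flux p \<in> borel_measurable borel"
  unfolding flux_def[abs_def] by measurable

text \<open>If both values are at most \<open>k\<close>, the ramp is 1 and truncation changes
  nothing. If both exceed \<open>k\<close>, the truncated difference is 0 and the ramp, being
  decreasing, gives the right sign. If b <= k < a, truncation makes the flux smaller, and the
  surplus goes into the error.\<close>

lemma flux_truncation_ineq_aux:
  assumes "1 \<le> p" "0 < e" "0 \<le> A" "0 \<le> B" "b \<le> a"
  shows "flux p (a - b) * (A * ramp k e a - B * ramp k e b)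
    \<le> flux p (min a k - min b k) * (A - B)
      + 2 * (\<bar>flux p (a - b) * (A - B)\<bar> * (if k < a then ramp k e a else 0))"
proof -
  let ?J = "flux p (a - b)" and ?h = "ramp k e a"
  have J: "0 \<le> ?J" using assms by (intro flux_nonneg) auto
  have h: "0 \<le> ?h" "?h \<le> 1" by (rule ramp_bounds)+
  have le: "x * (A - B) * ?h \<le> \<bar>?J * (A - B)\<bar> * ?h" "- (\<bar>?J * (A - B)\<bar> * ?h) \<le> x * (A - B) * ?h"
    if "0 \<le> x" "x \<le> ?J" for x
  proof -
    have "\<bar>x * (A - B)\<bar> \<le> \<bar>?J * (A - B)\<bar>"
      unfolding abs_mult using that by (intro mult_right_mono) auto
    then have "\<bar>x * (A - B) * ?h\<bar> \<le> \<bar>?J * (A - B)\<bar> * ?h"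
      using mult_right_mono[OF _ h(1)] by (simp add: abs_mult h)
    then show "x * (A - B) * ?h \<le> \<bar>?J * (A - B)\<bar> * ?h" "- (\<bar>?J * (A - B)\<bar> * ?h) \<le> x * (A - B) * ?h"
      by linarith+
  qed
  consider "a \<le> k" | "k < b" | "b \<le> k" "k < a" by linarith
  then show ?thesis
  proof cases
    case 1
    then show ?thesis using assms by (simp add: ramp_eq_1)
  next
    case 2
    have "0 \<le> ?J * (B * (ramp k e b - ?h))"
      using J assms by (intro mult_nonneg_nonneg) (auto intro: ramp_antimono)
    then have "?J * (A * ?h - B * ramp k e b) \<le> ?J * (A - B) * ?h" by (simp add: algebra_simps)
    also have "\<dots> \<le> \<bar>?J * (A - B)\<bar> * ?h" by (rule le) (use J in auto)
    also have "\<dots> \<le> 2 * (\<bar>?J * (A - B)\<bar> * ?h)" using h by simp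
    finally show ?thesis using 2 assms by (simp add: flux_def)
  next
    case 3
    let ?J' = "flux p (k - b)"
    have J': "0 \<le> ?J'" using 3 by (intro flux_nonneg) auto
    have JJ: "?J' \<le> ?J"
      using abs_flux_mono[of "k - b" "a - b" p] 3 assms J J' by simp
    \<comment> \<open>The term with \<open>1 - ?h\<close> is nonpositive, so there the flux
      \<open>?J\<close> may be lowered to the truncated flux \<open>?J'\<close>.\<close>
    have "?J * (A * ?h - B) = ?J * (A - B) * ?h - ?J * (B * (1 - ?h))" by (simp add: algebra_simps)
    also have "\<dots> \<le> \<bar>?J * (A - B)\<bar> * ?h - ?J' * (B * (1 - ?h))"
      using h assms by (intro diff_mono le mult_right_mono JJ J) auto
    \<comment> \<open>Adding the nonnegative term \<open>?J' * (A * (1 - ?h))\<close> completes the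
      factor \<open>A - B\<close>.\<close>
    also have "\<dots> \<le> \<bar>?J * (A - B)\<bar> * ?h + ?J' * (A - B) * (1 - ?h)"
    proof -
      have "0 \<le> ?J' * (A * (1 - ?h))" using J' h assms by simp
      then show ?thesis by (simp add: algebra_simps)
    qed
    also have "\<dots> = \<bar>?J * (A - B)\<bar> * ?h + ?J' * (A - B) - ?J' * (A - B) * ?h"
      by (simp add: algebra_simps)
    also have "\<dots> \<le> ?J' * (A - B) + 2 * (\<bar>?J * (A - B)\<bar> * ?h)"
      using le(2)[OF J' JJ] by linarith
    finally show ?thesis using 3 assms by (simp add: ramp_eq_1)
  qed
qed

text \<open>Exchanging the two points reverses the sign of both factors of each product, because
  \<open>flux\<close> is odd; this reduces everything to the ordered case.\<close>

lemma flux_truncation_ineq: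
  assumes "1 \<le> p" "0 < e" "0 \<le> A" "0 \<le> B"
  shows "flux p (a - b) * (A * ramp k e a - B * ramp k e b)
    \<le> flux p (min a k - min b k) * (A - B)
      + 2 * (\<bar>flux p (a - b) * (A - B)\<bar> * (if k < max a b then ramp k e (max a b) else 0))"
proof (cases "b \<le> a")
  case True
  then show ?thesis using flux_truncation_ineq_aux[OF assms True] by (simp only: max_absorb1)
next
  case False
  have m: "flux p (x - y) * z = flux p (y - x) * (- z)" for x y z
    using flux_minus[of p "y - x"] by simp
  have "\<bar>flux p (a - b) * (A - B)\<bar> = \<bar>flux p (b - a) * (B - A)\<bar>"
    using flux_minus[of p "b - a"] by (simp add: abs_mult abs_minus_commute)
  moreover have "max a b = b" using False by simp
  ultimately show ?thesis
    using flux_truncation_ineq_aux[OF assms(1,2,4,3), of a b k] False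
    unfolding m[of a b] m[of "min a k" "min b k"] minus_diff_eq by simp
qed

lemma test_function_properties:
  fixes \<eta> :: "'a::euclidean_space \<Rightarrow> real"
  assumes "\<eta> \<in> test_functions \<Omega>"
  obtains L M R S where "\<And>x y. \<bar>\<eta> x - \<eta> y\<bar> \<le> L * norm (x - y)" "\<And>x. \<bar>\<eta> x\<bar> \<le> M"
    "\<And>x. R < norm x \<Longrightarrow> \<eta> x = 0" "compact S" "S \<subseteq> \<Omega>" "\<And>x. x \<notin> S \<Longrightarrow> \<eta> x = 0"
    "\<eta> \<in> borel_measurable borel"
proof -
  let ?S = "closure {x. \<eta> x \<noteq> 0}"
  have C: "C_diff k \<eta>" for k using assms by (simp add: test_functions_def)
  have S: "compact ?S" "?S \<subseteq> \<Omega>"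
    using assms by (auto simp: test_functions_def compactly_contained_def)
  have supp: "\<eta> x = 0" if "x \<notin> ?S" for x using that closure_subset[of "{x. \<eta> x \<noteq> 0}"] by auto
  obtain R where R: "\<And>x. x \<in> ?S \<Longrightarrow> norm x \<le> R"
    using compact_imp_bounded[OF S(1)] by (auto simp: bounded_iff)
  then have R': "\<eta> x = 0" if "R < norm x" for x using that supp[of x] by force
  have cont: "continuous_on UNIV \<eta>" by (rule C_diff_continuous[OF C])
  obtain M where "\<And>x. \<bar>\<eta> x\<bar> \<le> M" using continuous_compact_support_bounded[OF cont R'] by blast
  moreover obtain L where "\<And>x y. \<bar>\<eta> x - \<eta> y\<bar> \<le> L * norm (x - y)"
    using C1_compact_support_lipschitz[OF C R'] by blast
  ultimately show ?thesis
    using that[of L M R ?S] R' S supp borel_measurable_continuous_onI[OF cont] by blast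
qed

lemma truncation_nonneg:
  fixes u :: "'a::euclidean_space \<Rightarrow> real" and \<kappa> :: "'a \<times> 'a \<Rightarrow> real" and s p :: real
  assumes form: "nonneg_form (\<lambda>q. flux p (u (fst q) - u (snd q)) * \<kappa> q) u
      (\<lambda>z. 1 / norm z powr (real DIM('a) + s * p)) p \<Lambda> \<Omega>"
    and s: "0 < s" "s < 1"
    and \<kappa>_meas [measurable]: "\<kappa> \<in> borel_measurable borel" and \<kappa>: "\<And>q. 0 \<le> \<kappa> q"
    and \<eta>: "\<eta> \<in> test_functions \<Omega>" "\<And>x. 0 \<le> \<eta> x"
  shows "0 \<le> (\<integral>q. flux p (min (u (fst q)) k - min (u (snd q)) k) * \<kappa> q * (\<eta> (fst q) - \<eta> (snd q)) \<partial>lborel)"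
proof -
  let ?w = "\<lambda>z::'a. 1 / norm z powr (real DIM('a) + s * p)"
  interpret nonneg_form "\<lambda>q. flux p (u (fst q) - u (snd q)) * \<kappa> q" u ?w p \<Lambda> \<Omega> by (rule form)
  obtain L M R S where lip: "\<And>x y. \<bar>\<eta> x - \<eta> y\<bar> \<le> L * norm (x - y)" and M: "\<And>x. \<bar>\<eta> x\<bar> \<le> M"
    and R: "\<And>x. R < norm x \<Longrightarrow> \<eta> x = 0" and S: "compact S" "S \<subseteq> \<Omega>" "\<And>x. x \<notin> S \<Longrightarrow> \<eta> x = 0"
    and [measurable]: "\<eta> \<in> borel_measurable borel"
    using test_function_properties[OF \<eta>(1)] by metis
  obtain D where D: "open D" "compactly_contained D \<Omega>" and SD: "S \<subseteq> D"
  proof -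
    obtain r and c :: real and D and \<psi> :: "'a \<Rightarrow> real" where
      "0 < r" "open D" "compactly_contained D \<Omega>" "(\<Union>x\<in>S. ball x r) \<subseteq> D"
      using ex_cutoff[OF S(1) \<Omega> S(2)] by metis
    then show ?thesis using that[of D] by force
  qed
  define F where "F q = flux p (u (fst q) - u (snd q)) * \<kappa> q * (\<eta> (fst q) - \<eta> (snd q))" for q
  define V where "V q = flux p (min (u (fst q)) k - min (u (snd q)) k) * \<kappa> q * (\<eta> (fst q) - \<eta> (snd q))" for q
  define m where "m q = max (u (fst q)) (u (snd q))" for q
  have [measurable]: "F \<in> borel_measurable borel" "V \<in> borel_measurable borel" "m \<in> borel_measurable borel"
    unfolding F_def[abs_def] V_def[abs_def] m_def[abs_def] by measurable
  have F_int: "integrable lborel F" using G_test[OF \<eta>] by (simp add: F_def[abs_def])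
  \<comment> \<open>Truncation shrinks differences and the size of \<open>flux\<close> grows with
    that of its argument, so \<open>F\<close> dominates \<open>V\<close>.\<close>
  have V_int: "integrable lborel V"
  proof (rule Bochner_Integration.integrable_bound[OF F_int])
    show "AE q in lborel. norm (V q) \<le> norm (F q)"
      using p by (intro AE_I2)
        (auto simp: F_def V_def abs_mult intro!: mult_right_mono abs_flux_mono abs_min_diff_le)
  qed simp
  define \<phi> where "\<phi> e x = \<eta> x * ramp k e (u x)" for e x
  have [measurable]: "\<phi> e \<in> borel_measurable borel" for e unfolding \<phi>_def by measurable
  define P where "P e q = flux p (u (fst q) - u (snd q)) * \<kappa> q * (\<phi> e (fst q) - \<phi> e (snd q))" for e q
  \<comment> \<open>This is the error in \<open>flux_truncation_ineq\<close>, multiplied by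
    \<open>\<kappa>\<close>. It is 0 where \<open>m q\<close> is at most \<open>k\<close>; elsewhere
    the ramp vanishes once \<open>e\<close> is at most \<open>m q - k\<close>. Hence it tends to 0
    pointwise.\<close>
  define Q where "Q e q = 2 * (\<bar>F q\<bar> * (if k < m q then ramp k e (m q) else 0))" for e q
  have [measurable]: "Q e \<in> borel_measurable borel" for e unfolding Q_def[abs_def] by measurable
  have Q_int: "integrable lborel (Q e)" for e
    by (rule Bochner_Integration.integrable_bound[OF integrable_mult_right[OF F_int, of 2]])
      (auto intro!: AE_I2 simp: Q_def abs_mult ramp_bounds mult_left_le)
  have V_ge: "0 \<le> (\<integral>q. V q \<partial>lborel) + (\<integral>q. Q e q \<partial>lborel)" if e: "0 < e" for e
  proof -
    have \<phi>_bounds: "0 \<le> \<phi> e x" "\<phi> e x \<le> \<eta> x" for x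
      using \<eta>(2)[of x] ramp_bounds[of k e "u x"] by (auto simp: \<phi>_def mult_left_le)
    \<comment> \<open>The energy of \<open>u\<close> is finite only locally, so its increment may
      enter only on \<open>D \<times> D\<close>. Off \<open>D \<times> D\<close> one of the points
      has \<open>\<eta>\<close> equal to 0, and 0 <= \<open>\<phi> e\<close> <=
      \<open>\<eta>\<close> bounds the increment by that of \<open>\<eta>\<close> alone.\<close>
    have \<phi>_diff: "\<bar>\<phi> e (fst q) - \<phi> e (snd q)\<bar>
        \<le> \<bar>\<eta> (fst q) - \<eta> (snd q)\<bar> + indicator (D \<times> D) q * (M / e * \<bar>u (fst q) - u (snd q)\<bar>)" for q
    proof (cases q)
      case (Pair x y)
      show ?thesis
      proof (cases "x \<in> D \<and> y \<in> D")
        case True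
        have "\<phi> e x - \<phi> e y = ramp k e (u x) * (\<eta> x - \<eta> y) + \<eta> y * (ramp k e (u x) - ramp k e (u y))"
          by (simp add: \<phi>_def algebra_simps)
        also have "\<bar>\<dots>\<bar> \<le> ramp k e (u x) * \<bar>\<eta> x - \<eta> y\<bar> + \<eta> y * \<bar>ramp k e (u x) - ramp k e (u y)\<bar>"
          by (rule order_trans[OF abs_triangle_ineq]) (simp add: abs_mult ramp_bounds \<eta>)
        also have "\<dots> \<le> 1 * \<bar>\<eta> x - \<eta> y\<bar> + M * (\<bar>u x - u y\<bar> / e)"
          using M[of y] \<eta>(2)[of y] e by (intro add_mono mult_mono ramp_lipschitz ramp_bounds) auto
        finally show ?thesis using Pair True by simp
      next
        case False
        then have "\<eta> x = 0 \<or> \<eta> y = 0" using S(3) SD by blast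
        then have "\<bar>\<phi> e x - \<phi> e y\<bar> \<le> \<bar>\<eta> x - \<eta> y\<bar>"
          using \<phi>_bounds[of x] \<phi>_bounds[of y] by auto
        then show ?thesis using Pair False by auto
      qed
    qed
    have \<phi>_gag: "integrable lborel (\<lambda>q. \<bar>\<phi> e (fst q) - \<phi> e (snd q)\<bar> powr p * ?w (fst q - snd q))"
    proof (rule Bochner_Integration.integrable_bound)
      show "integrable lborel (\<lambda>q. 2 powr p * (\<bar>\<eta> (fst q) - \<eta> (snd q)\<bar> powr p * ?w (fst q - snd q)
          + (M / e) powr p * (indicator (D \<times> D) q * (\<bar>u (fst q) - u (snd q)\<bar> powr p * ?w (fst q - snd q)))))"
        using integrable_gagliardo_lipschitz[OF s _ lip M R, of p] p u_local[OF D]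
        by (intro integrable_mult_right Bochner_Integration.integrable_add) (auto simp: case_prod_unfold)
      show "AE q in lborel. norm (\<bar>\<phi> e (fst q) - \<phi> e (snd q)\<bar> powr p * ?w (fst q - snd q))
        \<le> norm (2 powr p * (\<bar>\<eta> (fst q) - \<eta> (snd q)\<bar> powr p * ?w (fst q - snd q)
          + (M / e) powr p * (indicator (D \<times> D) q * (\<bar>u (fst q) - u (snd q)\<bar> powr p * ?w (fst q - snd q)))))"
      proof (intro AE_I2)
        fix q
        let ?U = "\<bar>u (fst q) - u (snd q)\<bar>" and ?E = "\<bar>\<eta> (fst q) - \<eta> (snd q)\<bar>"
        let ?i = "indicator (D \<times> D) q :: real" and ?W = "?w (fst q - snd q)"
        have M0: "0 \<le> M / e" using M[of 0] e by simp
        have "\<bar>\<phi> e (fst q) - \<phi> e (snd q)\<bar> powr p \<le> (?E + ?i * (M / e * ?U)) powr p"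
          using p \<phi>_diff by (intro powr_mono2) auto
        also have "\<dots> \<le> 2 powr p * (?E powr p + (?i * (M / e * ?U)) powr p)"
          using p by (intro powr_add_le mult_nonneg_nonneg M0) auto
        also have "(?i * (M / e * ?U)) powr p = (M / e) powr p * (?i * ?U powr p)"
          using M0 by (auto simp: powr_mult indicator_def simp del: times_divide_eq_left times_divide_eq_right)
        finally have "\<bar>\<phi> e (fst q) - \<phi> e (snd q)\<bar> powr p * ?W
            \<le> 2 powr p * (?E powr p + (M / e) powr p * (?i * ?U powr p)) * ?W"
          by (intro mult_right_mono) auto
        also have "\<dots> = 2 powr p * (?E powr p * ?W + (M / e) powr p * (?i * (?U powr p * ?W)))"
          by (simp only: algebra_simps)
        finally show "norm (\<bar>\<phi> e (fst q) - \<phi> e (snd q)\<bar> powr p * ?W)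
            \<le> norm (2 powr p * (?E powr p * ?W + (M / e) powr p * (?i * (?U powr p * ?W))))"
          by simp
      qed
    qed measurable
    have P: "integrable lborel (P e)" "0 \<le> (\<integral>q. P e q \<partial>lborel)"
      using nonneg_on_Sobolev_test[of "\<phi> e" M S, OF _ \<phi>_bounds(1) order_trans[OF \<phi>_bounds(2)] _ S(1,2) \<phi>_gag]
        M S(3) by (auto simp: P_def[abs_def] abs_le_iff \<phi>_def)
    have "P e q \<le> V q + Q e q" for q
    proof -
      have "flux p (u (fst q) - u (snd q)) * (\<phi> e (fst q) - \<phi> e (snd q)) * \<kappa> q
        \<le> (flux p (min (u (fst q)) k - min (u (snd q)) k) * (\<eta> (fst q) - \<eta> (snd q))
          + 2 * (\<bar>flux p (u (fst q) - u (snd q)) * (\<eta> (fst q) - \<eta> (snd q))\<bar>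
              * (if k < m q then ramp k e (m q) else 0))) * \<kappa> q"
        unfolding m_def \<phi>_def using p e \<eta>(2) \<kappa> by (intro mult_right_mono flux_truncation_ineq) auto
      also have "\<dots> = V q + Q e q"
        using \<kappa>[of q] by (simp add: V_def Q_def F_def abs_mult distrib_left distrib_right mult_ac)
      finally show ?thesis by (simp add: P_def mult_ac)
    qed
    then have "(\<integral>q. P e q \<partial>lborel) \<le> (\<integral>q. V q + Q e q \<partial>lborel)"
      using P(1) V_int Q_int by (intro integral_mono) auto
    then show ?thesis using P(2) V_int Q_int by simp
  qed
  have "(\<lambda>n. \<integral>q. Q (1 / real (Suc n)) q \<partial>lborel) \<longlonglongrightarrow> (\<integral>q. 0 \<partial>(lborel :: ('a \<times> 'a) measure))"
  proof (rule integral_dominated_convergence[where w = "\<lambda>q. 2 * \<bar>F q\<bar>"])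
    show "AE q in lborel. norm (Q (1 / real (Suc n)) q) \<le> 2 * \<bar>F q\<bar>" for n
      by (intro AE_I2) (auto simp: Q_def abs_mult ramp_bounds mult_left_le)
    show "AE q in lborel. (\<lambda>n. Q (1 / real (Suc n)) q) \<longlonglongrightarrow> 0"
    proof (intro AE_I2)
      fix q
      show "(\<lambda>n. Q (1 / real (Suc n)) q) \<longlonglongrightarrow> 0"
      proof (cases "k < m q")
        case True
        then obtain N where N: "1 / real (Suc N) < m q - k"
          using nat_approx_posE[of "m q - k"] by auto
        have "Q (1 / real (Suc n)) q = 0" if "N \<le> n" for n
        proof -
          have "1 / real (Suc n) \<le> 1 / real (Suc N)" using that by (intro divide_left_mono) auto
          then have "ramp k (1 / real (Suc n)) (m q) = 0" using N by (intro ramp_eq_0) auto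
          then show ?thesis by (simp add: Q_def)
        qed
        then show ?thesis
          by (intro tendsto_eventually) (auto simp: eventually_sequentially)
      qed (simp add: Q_def)
    qed
  qed (use F_int in auto)
  then have "(\<lambda>n. (\<integral>q. V q \<partial>lborel) + (\<integral>q. Q (1 / real (Suc n)) q \<partial>lborel)) \<longlonglongrightarrow> (\<integral>q. V q \<partial>lborel) + 0"
    by (intro tendsto_add) auto
  then have "0 \<le> (\<integral>q. V q \<partial>lborel) + 0"
    by (rule LIMSEQ_le_const) (use V_ge in auto)
  then show ?thesis by (simp add: V_def[abs_def])
qed

subsection \<open>Weak supersolutions\<close>

text \<open>The definitions use the completed measure, whereas Fubini and translations are used on
  \<open>lborel\<close>. A Borel function that agrees almost everywhere carries integrals from one
  to the other.\<close>

lemma lebesgue_borel_representative: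
  fixes f g :: "'a::euclidean_space \<Rightarrow> real"
  assumes g: "g \<in> borel_measurable borel" and ae: "AE x in lborel. f x = g x"
  shows "f \<in> borel_measurable lebesgue"
    and "integrable lebesgue f \<longleftrightarrow> integrable lborel g"
    and "integral\<^sup>L lebesgue f = integral\<^sup>L lborel g"
proof -
  have g': "g \<in> borel_measurable lebesgue" using g by (intro measurable_completion) simp
  have ae': "AE x in lebesgue. g x = f x"
    using AE_completion[OF ae] by eventually_elim simp
  show f: "f \<in> borel_measurable lebesgue" by (rule borel_measurable_AE[OF g' ae'])
  have "integrable lebesgue f \<longleftrightarrow> integrable lebesgue g"
    using ae' by (intro integrable_cong_AE f g') auto
  also have "\<dots> \<longleftrightarrow> integrable lborel g" using g by (intro integrable_completion) simp
  finally show "integrable lebesgue f \<longleftrightarrow> integrable lborel g" .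
  have "integral\<^sup>L lebesgue f = integral\<^sup>L lebesgue g"
    using ae' by (intro integral_cong_AE f g') auto
  also have "\<dots> = integral\<^sup>L lborel g" using g by (intro integral_completion) simp
  finally show "integral\<^sup>L lebesgue f = integral\<^sup>L lborel g" .
qed

lemma integrable_lebesgue_on_iff:
  fixes f g :: "'a::euclidean_space \<Rightarrow> real"
  assumes g: "g \<in> borel_measurable borel" and ae: "AE x in lborel. f x = g x" and U: "open U"
  shows "integrable (lebesgue_on U) f \<longleftrightarrow> integrable lborel (\<lambda>x. indicator U x * g x)"
proof -
  have [measurable]: "U \<in> sets borel" using U by simp
  have "integrable (lebesgue_on U) f \<longleftrightarrow> integrable lebesgue (\<lambda>x. indicator U x * f x)"
    using U by (subst integrable_restrict_space) (auto intro: lborelD)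
  also have "\<dots> \<longleftrightarrow> integrable lborel (\<lambda>x. indicator U x * g x)"
    using g ae by (intro lebesgue_borel_representative(2)) auto
  finally show ?thesis .
qed

lemma gagliardo_borel_representative:
  fixes u u0 :: "'a::euclidean_space \<Rightarrow> real"
  assumes "AE x in lborel. u x = u0 x"
  shows "AE q in lborel. (case q of (x, y) \<Rightarrow> \<bar>u x - u y\<bar> powr p / norm (x - y) powr a)
    = \<bar>u0 (fst q) - u0 (snd q)\<bar> powr p * (1 / norm (fst q - snd q) powr a)"
  using AE_lborel_prod[OF assms] by eventually_elim (simp add: case_prod_unfold)

section \<open>Stability of the function spaces under truncation\<close>

lemma powr_le_add_powr:
  fixes a b c q :: real
  assumes "0 \<le> a" "a \<le> max b c" "0 \<le> q"
  shows "a powr q \<le> \<bar>b\<bar> powr q + \<bar>c\<bar> powr q"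
proof -
  have "a powr q \<le> max \<bar>b\<bar> \<bar>c\<bar> powr q" using assms by (intro powr_mono2) auto
  also have "\<dots> \<le> \<bar>b\<bar> powr q + \<bar>c\<bar> powr q" by (auto simp: max_def)
  finally show ?thesis .
qed

text \<open>Finite measure of \<open>U\<close> makes the constant integrable, and the power of a
  maximum is at most the sum of the powers.\<close>

lemma Lebesgue_Lp_truncation:
  fixes f g :: "'a::euclidean_space \<Rightarrow> real"
  assumes f: "f \<in> Lebesgue_Lp q U" and g: "g \<in> borel_measurable lebesgue" and "0 \<le> q"
    and le: "\<And>x. \<bar>g x\<bar> \<le> max \<bar>f x\<bar> c" and U: "U \<in> lmeasurable"
  shows "g \<in> Lebesgue_Lp q U"
proof -
  have gm: "g \<in> borel_measurable (lebesgue_on U)" using g by (rule measurable_restrict_space1)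
  have "integrable (lebesgue_on U) (\<lambda>x. \<bar>g x\<bar> powr q)"
  proof (rule Bochner_Integration.integrable_bound)
    show "integrable (lebesgue_on U) (\<lambda>x. \<bar>f x\<bar> powr q + \<bar>c\<bar> powr q)"
      using f finite_measure_lebesgue_on[OF U]
      by (auto simp: Lebesgue_Lp_def intro!: finite_measure.integrable_const)
    show "AE x in lebesgue_on U. norm (\<bar>g x\<bar> powr q) \<le> norm (\<bar>f x\<bar> powr q + \<bar>c\<bar> powr q)"
      using le \<open>0 \<le> q\<close> powr_le_add_powr[of "\<bar>g _\<bar>" "\<bar>f _\<bar>" c q] by (intro AE_I2) simp
    show "(\<lambda>x. \<bar>g x\<bar> powr q) \<in> borel_measurable (lebesgue_on U)" using gm by measurable
  qed
  with gm show ?thesis by (simp add: Lebesgue_Lp_def)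
qed

text \<open>Truncation is 1-Lipschitz, so the Gagliardo integrand does not grow. In the L^p part
  \<open>k\<close> contributes a constant, which is integrable because \<open>D\<close> is
  bounded.\<close>

lemma truncation_Wsp_loc:
  fixes u :: "real^'n \<Rightarrow> real"
  assumes u: "u \<in> Wsp_loc s p \<Omega>" and meas: "u \<in> borel_measurable lebesgue" and p: "0 \<le> p"
  shows "(\<lambda>x. min (u x) k) \<in> Wsp_loc s p \<Omega>"
  unfolding Wsp_loc_def
proof (intro CollectI allI impI, elim conjE)
  fix D assume D: "open D" "compactly_contained D \<Omega>"
  then have uD: "u \<in> Lebesgue_Lp p D" and gag: "integrable (lebesgue_on (D \<times> D))
       (\<lambda>(x, y). \<bar>u x - u y\<bar> powr p / norm (x - y) powr (real CARD('n) + s * p))"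
    using u by (auto simp: Wsp_loc_def Wsp_def)
  have "bounded D"
    using D(2) closure_subset bounded_subset compact_imp_bounded by (metis compactly_contained_def)
  then have "D \<in> lmeasurable" using D(1) by (rule lmeasurable_open)
  then have "(\<lambda>x. min (u x) k) \<in> Lebesgue_Lp p D"
    using meas p by (intro Lebesgue_Lp_truncation[OF uD, where c = "\<bar>k\<bar>"]) (auto simp: min_def)
  moreover have "integrable (lebesgue_on (D \<times> D))
       (\<lambda>(x, y). \<bar>min (u x) k - min (u y) k\<bar> powr p / norm (x - y) powr (real CARD('n) + s * p))"
  proof (rule Bochner_Integration.integrable_bound[OF gag])
    \<comment> \<open>The Borel representative serves to show that the integrand is measurable on
      pairs.\<close>
    obtain u0 where u0: "u0 \<in> borel_measurable lborel" "AE x in lborel. u x = u0 x"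
      using completion_ex_borel_measurable_real[OF meas] by blast
    have [measurable]: "u0 \<in> borel_measurable borel" using u0(1) by simp
    have "AE x in lborel. min (u x) k = min (u0 x) k" using u0(2) by eventually_elim simp
    note ae = gagliardo_borel_representative[OF this, of p "real CARD('n) + s * p"]
    have "(\<lambda>(x, y). \<bar>min (u x) k - min (u y) k\<bar> powr p / norm (x - y) powr (real CARD('n) + s * p))
        \<in> borel_measurable lebesgue"
      by (rule lebesgue_borel_representative(1)[OF _ ae]) measurable
    then show "(\<lambda>(x, y). \<bar>min (u x) k - min (u y) k\<bar> powr p / norm (x - y) powr (real CARD('n) + s * p))
        \<in> borel_measurable (lebesgue_on (D \<times> D))"
      by (rule measurable_restrict_space1)
    show "AE q in lebesgue_on (D \<times> D).
        norm (case q of (x, y) \<Rightarrow> \<bar>min (u x) k - min (u y) k\<bar> powr p / norm (x - y) powr (real CARD('n) + s * p))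
        \<le> norm (case q of (x, y) \<Rightarrow> \<bar>u x - u y\<bar> powr p / norm (x - y) powr (real CARD('n) + s * p))"
      using p by (intro AE_I2) (auto intro!: divide_right_mono powr_mono2 abs_min_diff_le)
  qed
  ultimately show "(\<lambda>x. min (u x) k) \<in> Wsp s p D" by (simp add: Wsp_def)
qed

text \<open>The new negative part is at most the maximum of the old one and |k|, and constants lie
  in the tail space because its weight is integrable when sp > 0.\<close>

lemma truncation_tail_space:
  fixes u :: "real^'n \<Rightarrow> real"
  assumes u: "(\<lambda>x. max (- u x) 0) \<in> tail_space s p" and meas: "u \<in> borel_measurable lebesgue"
    and p: "1 < p" and s: "0 < s"
  shows "(\<lambda>x. max (- min (u x) k) 0) \<in> tail_space s p"
proof -
  let ?f = "\<lambda>x. max (- u x) 0" and ?g = "\<lambda>x. max (- min (u x) k) 0"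
  let ?W = "\<lambda>x::real^'n. (1 + norm x) powr (- real CARD('n) - s * p)"
  have gm: "?g \<in> borel_measurable lebesgue" using meas by measurable
  have le: "\<bar>?g x\<bar> \<le> max \<bar>?f x\<bar> \<bar>k\<bar>" for x by (auto simp: min_def max_def)
  have W: "integrable lebesgue ?W"
    using integrable_one_plus_norm_powr[of "s * p", where ?'a = "real^'n"] p s
    by (subst integrable_completion) auto
  have "integrable lebesgue (\<lambda>x. \<bar>?g x\<bar> powr (p - 1) * ?W x)"
  proof (rule Bochner_Integration.integrable_bound)
    show "integrable lebesgue (\<lambda>x. \<bar>?f x\<bar> powr (p - 1) * ?W x + \<bar>k\<bar> powr (p - 1) * ?W x)"
      using u W by (intro Bochner_Integration.integrable_add integrable_mult_right) (auto simp: tail_space_def)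
    have "?W \<in> borel_measurable lebesgue" using borel_measurable_integrable[OF W] .
    with gm show "(\<lambda>x. \<bar>?g x\<bar> powr (p - 1) * ?W x) \<in> borel_measurable lebesgue" by measurable
    show "AE x in lebesgue. norm (\<bar>?g x\<bar> powr (p - 1) * ?W x)
        \<le> norm (\<bar>?f x\<bar> powr (p - 1) * ?W x + \<bar>k\<bar> powr (p - 1) * ?W x)"
    proof (intro AE_I2)
      fix x
      have "\<bar>?g x\<bar> powr (p - 1) \<le> \<bar>?f x\<bar> powr (p - 1) + \<bar>k\<bar> powr (p - 1)"
        using powr_le_add_powr[OF _ le[of x], of "p - 1"] p by simp
      then have "\<bar>?g x\<bar> powr (p - 1) * ?W x \<le> (\<bar>?f x\<bar> powr (p - 1) + \<bar>k\<bar> powr (p - 1)) * ?W x"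
        by (intro mult_right_mono) auto
      then show "norm (\<bar>?g x\<bar> powr (p - 1) * ?W x)
          \<le> norm (\<bar>?f x\<bar> powr (p - 1) * ?W x + \<bar>k\<bar> powr (p - 1) * ?W x)"
        by (simp add: distrib_right)
    qed
  qed
  moreover have "?g \<in> Lebesgue_Lp (p - 1) C" if "compact C" for C
  proof (rule Lebesgue_Lp_truncation[OF _ gm _ le lmeasurable_compact[OF that]])
    show "?f \<in> Lebesgue_Lp (p - 1) C" using u that by (simp add: tail_space_def)
  qed (use p in simp)
  ultimately show ?thesis using gm by (simp add: tail_space_def)
qed

section \<open>Transfer from the Lebesgue formulation to Borel data\<close>

theorem lemma7:
  fixes s p \<Lambda> :: real
    and K :: "real^'n \<Rightarrow> real^'n \<Rightarrow> real"
    and \<Omega> :: "(real^'n) set"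
    and u :: "real^'n \<Rightarrow> real"
  assumes "0 < s" "s < 1" "1 < p" "1 \<le> \<Lambda>"
    and "sp_kernel s p \<Lambda> K"
    and "open \<Omega>"
    and "weak_supersolution s p K \<Omega> u"
  shows "\<forall>k::real. weak_supersolution s p K \<Omega> (\<lambda>x. min (u x) k)"
proof
  fix k :: real
  let ?w = "\<lambda>z::real^'n. 1 / norm z powr (real CARD('n) + s * p)"
  have meas: "u \<in> borel_measurable lebesgue" and loc: "u \<in> Wsp_loc s p \<Omega>"
    and tail: "(\<lambda>x. max (- u x) 0) \<in> tail_space s p"
    and test: "\<And>\<eta>. \<eta> \<in> test_functions \<Omega> \<Longrightarrow> (\<And>x. 0 \<le> \<eta> x) \<Longrightarrow>
        integrable lebesgue (weak_form_integrand p K u \<eta>) \<and>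
        0 \<le> integral\<^sup>L lebesgue (weak_form_integrand p K u \<eta>)"
    using assms(7) by (auto simp: weak_supersolution_def)
  obtain u0 where u0: "u0 \<in> borel_measurable lborel" "AE x in lborel. u x = u0 x"
    using completion_ex_borel_measurable_real[OF meas] by blast
  have [measurable]: "u0 \<in> borel_measurable borel" using u0(1) by simp
  have "(\<lambda>(x, y). K x y) \<in> borel_measurable lebesgue" using assms(5) by (simp add: sp_kernel_def)
  then obtain K0 where K0: "K0 \<in> borel_measurable lborel"
    "AE q in lborel. (case q of (x, y) \<Rightarrow> K x y) = K0 q"
    using completion_ex_borel_measurable_real by blast
  have [measurable]: "K0 \<in> borel_measurable borel" using K0(1) by simp
  txt \<open>Truncating makes the kernel bound hold everywhere instead of almost everywhere.\<close>
  define \<kappa> where "\<kappa> q = max 0 (min (K0 q) (\<Lambda> * ?w (fst q - snd q)))" for q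
  have \<kappa>_meas [measurable]: "\<kappa> \<in> borel_measurable borel" unfolding \<kappa>_def[abs_def] by measurable
  have "AE q in lebesgue. K (fst q) (snd q) * norm (fst q - snd q) powr (real CARD('n) + s * p) \<le> \<Lambda>"
    using assms(5) by (auto simp: sp_kernel_def case_prod_unfold)
  then have K_le: "AE q in lborel. K (fst q) (snd q) * norm (fst q - snd q) powr (real CARD('n) + s * p) \<le> \<Lambda>"
    by (simp add: AE_completion_iff)
  have K_nonneg: "0 \<le> K x y" for x y using assms(5) by (simp add: sp_kernel_def)
  txt \<open>On the diagonal \<open>w 0 = 1 / 0 = 0\<close>, so \<open>\<kappa>\<close> may differ from \<open>K\<close> there, where the integrands vanish anyway.\<close>
  have K_eq: "AE q in lborel. fst q = snd q \<or> K (fst q) (snd q) = \<kappa> q"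
    using K_le K0(2)
  proof eventually_elim
    case (elim q)
    show ?case
    proof (cases "fst q = snd q")
      case False
      then have "K (fst q) (snd q) \<le> \<Lambda> * ?w (fst q - snd q)"
        using elim(1) by (simp add: field_simps)
      then show ?thesis using elim(2) K_nonneg[of "fst q" "snd q"]
        by (simp add: \<kappa>_def case_prod_unfold)
    qed simp
  qed
  \<comment> \<open>Stated for arbitrary \<open>v\<close>, so that it serves both \<open>u\<close>
    and its truncation. On the diagonal both sides are 0.\<close>
  have form_eq: "AE q in lborel. weak_form_integrand p K v \<eta> q
      = flux p (v0 (fst q) - v0 (snd q)) * \<kappa> q * (\<eta> (fst q) - \<eta> (snd q))"
    if "AE x in lborel. v x = v0 x" for v v0 \<eta> :: "real^'n \<Rightarrow> real"
    using AE_lborel_prod[OF that] K_eq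
    by eventually_elim (auto simp: weak_form_integrand_def flux_def case_prod_unfold)
  have form_iff: "integrable lebesgue (weak_form_integrand p K v \<eta>) \<longleftrightarrow>
        integrable lborel (\<lambda>q. flux p (v0 (fst q) - v0 (snd q)) * \<kappa> q * (\<eta> (fst q) - \<eta> (snd q)))"
      "integral\<^sup>L lebesgue (weak_form_integrand p K v \<eta>) =
        (\<integral>q. flux p (v0 (fst q) - v0 (snd q)) * \<kappa> q * (\<eta> (fst q) - \<eta> (snd q)) \<partial>lborel)"
    if "AE x in lborel. v x = v0 x" "v0 \<in> borel_measurable borel" "\<eta> \<in> test_functions \<Omega>"
    for v v0 \<eta> :: "real^'n \<Rightarrow> real"
  proof -
    have [measurable]: "\<eta> \<in> borel_measurable borel" "v0 \<in> borel_measurable borel"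
      using test_function_properties[OF that(3)] that(2) by metis+
    show "integrable lebesgue (weak_form_integrand p K v \<eta>) \<longleftrightarrow>
        integrable lborel (\<lambda>q. flux p (v0 (fst q) - v0 (snd q)) * \<kappa> q * (\<eta> (fst q) - \<eta> (snd q)))"
      by (rule lebesgue_borel_representative(2)[OF _ form_eq[OF that(1)]]) measurable
    show "integral\<^sup>L lebesgue (weak_form_integrand p K v \<eta>) =
        (\<integral>q. flux p (v0 (fst q) - v0 (snd q)) * \<kappa> q * (\<eta> (fst q) - \<eta> (snd q)) \<partial>lborel)"
      by (rule lebesgue_borel_representative(3)[OF _ form_eq[OF that(1)]]) measurable
  qed
  have form: "nonneg_form (\<lambda>q. flux p (u0 (fst q) - u0 (snd q)) * \<kappa> q) u0
      (\<lambda>z. 1 / norm z powr (real DIM(real^'n) + s * p)) p \<Lambda> \<Omega>"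
  proof
    show "\<bar>flux p (u0 (fst (x, y)) - u0 (snd (x, y))) * \<kappa> (x, y)\<bar>
        \<le> \<Lambda> * (\<bar>u0 x - u0 y\<bar> powr (p - 1) * (1 / norm (x - y) powr (real DIM(real^'n) + s * p)))" for x y
    proof -
      have "\<bar>u0 x - u0 y\<bar> powr (p - 1) * \<bar>\<kappa> (x, y)\<bar> \<le> \<bar>u0 x - u0 y\<bar> powr (p - 1) * (\<Lambda> * ?w (x - y))"
        using assms(4) by (intro mult_left_mono) (auto simp: \<kappa>_def)
      then show ?thesis by (simp add: abs_mult abs_flux mult_ac)
    qed
    show "integrable lborel (\<lambda>q. flux p (u0 (fst q) - u0 (snd q)) * \<kappa> q * (\<eta> (fst q) - \<eta> (snd q))) \<and>
        0 \<le> (\<integral>q. flux p (u0 (fst q) - u0 (snd q)) * \<kappa> q * (\<eta> (fst q) - \<eta> (snd q)) \<partial>lborel)"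
      if "\<eta> \<in> test_functions \<Omega>" "\<And>x. 0 \<le> \<eta> x" for \<eta>
      using test[OF that] form_iff[OF u0(2) _ that(1)] by simp
    show "integrable lborel (\<lambda>q. indicator (D \<times> D) q * (\<bar>u0 (fst q) - u0 (snd q)\<bar> powr p
        * (1 / norm (fst q - snd q) powr (real DIM(real^'n) + s * p))))"
      if D: "open D" "compactly_contained D \<Omega>" for D
    proof -
      have "integrable (lebesgue_on (D \<times> D))
          (\<lambda>(x, y). \<bar>u x - u y\<bar> powr p / norm (x - y) powr (real CARD('n) + s * p))"
        using loc D by (auto simp: Wsp_loc_def Wsp_def)
      then show ?thesis
        by (subst (asm) integrable_lebesgue_on_iff[OF _ gagliardo_borel_representative[OF u0(2)]])
           (auto intro: open_Times D)
    qed
  qed (use assms in auto)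
  have v0: "AE x in lborel. min (u x) k = min (u0 x) k" using u0(2) by eventually_elim simp
  show "weak_supersolution s p K \<Omega> (\<lambda>x. min (u x) k)"
    unfolding weak_supersolution_def
  proof (intro conjI ballI impI)
    show "(\<lambda>x. min (u x) k) \<in> borel_measurable lebesgue" using meas by measurable
    show "(\<lambda>x. min (u x) k) \<in> Wsp_loc s p \<Omega>"
      using truncation_Wsp_loc[OF loc meas] assms by simp
    show "(\<lambda>x. max (- min (u x) k) 0) \<in> tail_space s p"
      using truncation_tail_space[OF tail meas] assms by simp
    fix \<eta> :: "real^'n \<Rightarrow> real" assume \<eta>: "\<eta> \<in> test_functions \<Omega>" "\<forall>x. 0 \<le> \<eta> x"
    have [measurable]: "\<eta> \<in> borel_measurable borel"
      using test_function_properties[OF \<eta>(1)] by metis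
    note iff = form_iff[OF v0 _ \<eta>(1)]
    \<comment> \<open>\<open>weak_supersolution\<close> asks for integrability besides the sign; the
      integrand of \<open>u0\<close> dominates that of its truncation.\<close>
    have "integrable lborel (\<lambda>q. flux p (min (u0 (fst q)) k - min (u0 (snd q)) k) * \<kappa> q * (\<eta> (fst q) - \<eta> (snd q)))"
    proof (rule Bochner_Integration.integrable_bound)
      show "integrable lborel (\<lambda>q. flux p (u0 (fst q) - u0 (snd q)) * \<kappa> q * (\<eta> (fst q) - \<eta> (snd q)))"
        using test[OF \<eta>(1)] \<eta>(2) form_iff[OF u0(2) _ \<eta>(1)] by simp
      show "AE q in lborel. norm (flux p (min (u0 (fst q)) k - min (u0 (snd q)) k) * \<kappa> q * (\<eta> (fst q) - \<eta> (snd q)))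
          \<le> norm (flux p (u0 (fst q) - u0 (snd q)) * \<kappa> q * (\<eta> (fst q) - \<eta> (snd q)))"
        using assms(3) by (intro AE_I2)
          (auto simp: abs_mult intro!: mult_right_mono abs_flux_mono abs_min_diff_le)
    qed measurable
    then show "integrable lebesgue (weak_form_integrand p K (\<lambda>x. min (u x) k) \<eta>)"
      using iff(1) by simp
    show "0 \<le> integral\<^sup>L lebesgue (weak_form_integrand p K (\<lambda>x. min (u x) k) \<eta>)"
      using truncation_nonneg[OF form assms(1,2) _ _ \<eta>(1)] \<eta>(2) iff(2) by (simp add: \<kappa>_def)
  qed
qed

end
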